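(* Let $\mathbf{k}$ be an algebraically closed field and let $R$ be a finitely generated one-dimensional $\mathbf{k}$-domain. Take a projective closure $\overline{X}$ of the affine curve $X = \operatorname{Spec}(R)$ such that $\overline{X}$ is non-singular at every point of $\overline{X} \setminus X$. If $\overline{X} \setminus X$ contains just a single point, then $R$ has no extending maximal $\mathbf{k}$-subalgebra. Otherwise, for any point $p \in \overline{X} \setminus X$, $$\{\, f \in R \mid f \text{ is defined at } p \,\}$$ is an extending maximal $\mathbf{k}$-subalgebra of $R$, and every extending maximal $\mathbf{k}$-subalgebra of $R$ is of this form.
   Context: All rings are commutative with unity. A proper subring $A \subsetneq R$ is a maximal subring if there is no ring strictly between $A$ and $R$; a maximal $\mathbf{k}$-subalgebra is a maximal subring that is a $\mathbf{k}$-subalgebra. A maximal subring $A \subsetneq R$ is called extending if the induced morphism $\operatorname{Spec}(R) \to \operatorname{Spec}(A)$ is not surjective (otherwise it is called non-extending). An element $f \in R$ is viewed as a rational function on $\overline{X}$; it is defined at $p$ if it lies in the local ring $\mathcal{O}_{\overline{X},p}$. *)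

theory Defs
  imports
    "HOL-Algebra.Algebraic_Closure_Type"
    "HOL-Algebra.Generated_Rings"
    "HOL-Algebra.Ring_Divisibility"
    "HOL-Library.Extended_Nat"
begin

abbreviation ring_on :: "'a::comm_ring_1 set \<Rightarrow> 'a ring" where
  "ring_on A \<equiv> ring_of_type_algebra\<lparr>carrier := A\<rparr>"

definition prime_spectrum :: "('a, 'm) ring_scheme \<Rightarrow> 'a set set" where
  "prime_spectrum R = {P. primeideal P R}"

definition krull_dim :: "('a, 'm) ring_scheme \<Rightarrow> enat" where
  "krull_dim R = Sup {enat n | n.
     \<exists>P :: nat \<Rightarrow> 'a set. (\<forall>i\<le>n. P i \<in> prime_spectrum R) \<and> (\<forall>i<n. P i \<subset> P (Suc i))}"

text \<open>
  A Noetherian local ring is regular if its maximal ideal can be generated by as many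
  elements as the Krull dimension says.
\<close>

definition regular_local_ring :: "('a, 'm) ring_scheme \<Rightarrow> bool" where
  "regular_local_ring R \<longleftrightarrow>
     cring R \<and> noetherian_ring R \<and> (\<exists>!M. maximalideal M R) \<and>
     (\<exists>S \<subseteq> carrier R. finite S \<and> enat (card S) = krull_dim R \<and> maximalideal (Idl\<^bsub>R\<^esub> S) R)"

definition maximal_subring :: "'a set \<Rightarrow> ('a, 'm) ring_scheme \<Rightarrow> bool" where
  "maximal_subring A R \<longleftrightarrow>
     subring A R \<and> A \<noteq> carrier R \<and>
     \<not> (\<exists>B. subring B R \<and> A \<subset> B \<and> B \<subset> carrier R)"

text \<open>
  The morphism from \<open>Spec R\<close> to \<open>Spec A\<close> induced by the inclusion of \<open>A\<close> in \<open>R\<close> sends a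
  prime ideal \<open>Q\<close> of \<open>R\<close> to its contraction \<open>Q \<inter> A\<close>.
\<close>

definition extending :: "'a set \<Rightarrow> ('a, 'm) ring_scheme \<Rightarrow> bool" where
  "extending A R \<longleftrightarrow>
     \<not> prime_spectrum (R\<lparr>carrier := A\<rparr>) \<subseteq> (\<lambda>Q. Q \<inter> A) ` prime_spectrum R"

text \<open>
  In the following two definitions a \<open>k\<close>-algebra structure on a ring is given by its structure
  homomorphism \<open>\<eta>\<close>.
\<close>

definition finitely_generated_algebra :: "('k \<Rightarrow> 'r::comm_ring_1) \<Rightarrow> bool" where
  "finitely_generated_algebra \<eta> \<longleftrightarrow>
     (\<exists>S. finite S \<and> generate_ring ring_of_type_algebra (range \<eta> \<union> S) = UNIV)"

definition extending_maximal_subalgebra :: "('k \<Rightarrow> 'r::comm_ring_1) \<Rightarrow> 'r set \<Rightarrow> bool" where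
  "extending_maximal_subalgebra \<eta> A \<longleftrightarrow>
     maximal_subring A ring_of_type_algebra \<and> range \<eta> \<subseteq> A \<and>
     extending A ring_of_type_algebra"

text \<open>
  An integral separated scheme with function field \<open>K\<close> is represented, as in
  Zariski's models and in EGA I, section 8 (Chevalley schemes), by the set of the local rings
  of its points, taken as subrings of \<open>K\<close>. As the scheme is separated, distinct points
  have distinct local rings, so a point is identified with its local ring. The generic
  point corresponds to \<open>K\<close> itself.
\<close>

definition localization_at :: "'a::field set \<Rightarrow> 'a set \<Rightarrow> 'a set" where
  "localization_at B P = {a / b | a b. a \<in> B \<and> b \<in> B - P}"

definition affine_model :: "'a::field set \<Rightarrow> 'a set set" where
  "affine_model B = localization_at B ` prime_spectrum (ring_on B)"

text \<open>
  The integral closed subscheme of projective \<open>n\<close>-space over \<open>k\<close> whose generic point has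
  homogeneous coordinates \<open>x 0 : \<dots> : x n\<close> is covered by the spectra of the rings
  \<open>k[x 0 / x i, \<dots>, x n / x i]\<close> with \<open>x i \<noteq> 0\<close>. Its function field is the common fraction
  field of these rings.
\<close>

definition standard_chart :: "'a::field set \<Rightarrow> nat \<Rightarrow> (nat \<Rightarrow> 'a) \<Rightarrow> nat \<Rightarrow> 'a set" where
  "standard_chart k n x i =
     generate_ring ring_of_type_algebra (k \<union> {x j / x i | j. j \<le> n})"

definition projective_model :: "'a::field set \<Rightarrow> 'a set set \<Rightarrow> bool" where
  "projective_model k Z \<longleftrightarrow>
     (\<exists>n x. (\<exists>i\<le>n. x i \<noteq> 0) \<and>
        Z = (\<Union>i \<in> {i. i \<le> n \<and> x i \<noteq> 0}. affine_model (standard_chart k n x i)))"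

text \<open>
  A domain \<open>R\<close> is a type of class \<open>idom\<close>, embedded by \<open>to_fract\<close> in its fraction field.
\<close>

definition affine_variety_of :: "'r::idom itself \<Rightarrow> 'r fract set set" where
  "affine_variety_of _ = affine_model (range (to_fract :: 'r \<Rightarrow> 'r fract))"

text \<open>
  If \<open>Spec R\<close> is contained in \<open>Z\<close> then \<open>K\<close>, the local ring at its generic point, lies in
  \<open>Z\<close>, so that \<open>Z\<close> has function field \<open>K\<close> and the same generic point. For \<open>R\<close> finitely
  generated over \<open>k\<close>, the points of \<open>Spec R\<close> are then exactly the points of \<open>Z\<close> whose local
  rings contain a fixed finite set of generators, so \<open>Spec R\<close> is a dense open subscheme of \<open>Z\<close>.
\<close>

definition projective_closure :: "('k \<Rightarrow> 'r::idom) \<Rightarrow> 'r fract set set \<Rightarrow> bool" where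
  "projective_closure \<eta> Z \<longleftrightarrow>
     projective_model (range (\<lambda>c. to_fract (\<eta> c))) Z \<and> affine_variety_of TYPE('r) \<subseteq> Z"

end

theory Submission
  imports Defs
begin

text \<open>
  Let \<open>K\<close> be the fraction field of \<open>R\<close>. A regular local ring of dimension one is a maximal proper
  subring of \<open>K\<close>, so by the valuative criterion the points at infinity of the projective
  closure are exactly the valuation rings \<open>V \<noteq> K\<close> of \<open>K\<close> over \<open>k\<close> that do not contain \<open>R\<close>; they
  are discrete, with residue field \<open>k\<close>.

  If \<open>A\<close> is an extending maximal subalgebra and \<open>P\<close> a prime of \<open>A\<close> that is not contracted from \<open>R\<close>,
  then no valuation ring \<open>V\<close> dominating \<open>A\<close> localised at \<open>P\<close> contains \<open>R\<close>, and hence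
  \<open>A = R \<inter> V\<close> by maximality. A nonzero element of \<open>P\<close> is not in \<open>k\<close>, so it is transcendental and
  has a pole at a second point at infinity.

  Conversely, let \<open>V\<close> be one of at least two points at infinity. Comparing pole orders gives
  \<open>0 \<noteq> h \<in> R\<close> vanishing at \<open>V\<close>. For \<open>f \<in> R - V\<close> some product \<open>w = f\<^sup>i h\<^sup>j\<close> with \<open>j > 0\<close> is a unit of
  \<open>V\<close>. It lies in every prime of \<open>R\<close> containing \<open>h\<close>, so the centre of \<open>V\<close> on \<open>R \<inter> V\<close> is not
  contracted from \<open>R\<close>. Writing \<open>w = c + \<pi>\<close> with \<open>c \<in> k\<close> and \<open>\<pi>\<close> vanishing at \<open>V\<close>, the identity
  \<open>c g = f\<^sup>i (h\<^sup>j g) - \<pi> g\<close> lowers the pole order of \<open>g \<in> R\<close> at \<open>V\<close> and shows that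
  \<open>R \<inter> V\<close> and \<open>f\<close> generate \<open>R\<close>.

  Dimension theory is replaced by valuations: algebraic dependence, Zariski's lemma and the
  Nullstellensatz are all read off from Chevalley's extension theorem.
\<close>

section \<open>Subrings and ideals\<close>

text \<open>Subrings are carried as plain subsets of a type; \<open>subring_iff_subring_set\<close>
  compares them with the library notion.\<close>

definition subring_set :: "'a::comm_ring_1 set \<Rightarrow> bool" where
  "subring_set A \<longleftrightarrow> 1 \<in> A \<and> (\<forall>x\<in>A. \<forall>y\<in>A. x - y \<in> A \<and> x * y \<in> A)"

lemma subring_set_one [simp]: "subring_set A \<Longrightarrow> 1 \<in> A"
  and subring_set_diff: "subring_set A \<Longrightarrow> x \<in> A \<Longrightarrow> y \<in> A \<Longrightarrow> x - y \<in> A"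
  and subring_set_mult: "subring_set A \<Longrightarrow> x \<in> A \<Longrightarrow> y \<in> A \<Longrightarrow> x * y \<in> A"
  by (auto simp: subring_set_def)

lemma subring_set_zero [simp]: "subring_set A \<Longrightarrow> 0 \<in> A"
  using subring_set_diff[of A 1 1] by simp

lemma subring_set_uminus: "subring_set A \<Longrightarrow> x \<in> A \<Longrightarrow> - x \<in> A"
  using subring_set_diff[of A 0 x] by simp

lemma subring_set_add: "subring_set A \<Longrightarrow> x \<in> A \<Longrightarrow> y \<in> A \<Longrightarrow> x + y \<in> A"
  using subring_set_diff[of A x "- y"] subring_set_uminus by fastforce

lemma subring_set_power: "subring_set A \<Longrightarrow> x \<in> A \<Longrightarrow> x ^ n \<in> A"
  by (induction n) (auto intro: subring_set_mult)

lemmas subring_set_closed =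
  subring_set_diff subring_set_mult subring_set_uminus subring_set_add subring_set_power

lemma subring_set_UNIV [simp]: "subring_set UNIV"
  by (simp add: subring_set_def)

definition ideal_of :: "'a::comm_ring_1 set \<Rightarrow> 'a set \<Rightarrow> bool" where
  "ideal_of I A \<longleftrightarrow> I \<subseteq> A \<and> 0 \<in> I \<and> (\<forall>x\<in>I. \<forall>y\<in>I. x + y \<in> I) \<and> (\<forall>a\<in>A. \<forall>x\<in>I. a * x \<in> I)"

lemma ideal_of_subset: "ideal_of I A \<Longrightarrow> x \<in> I \<Longrightarrow> x \<in> A"
  and ideal_of_zero [simp]: "ideal_of I A \<Longrightarrow> 0 \<in> I"
  and ideal_of_add: "ideal_of I A \<Longrightarrow> x \<in> I \<Longrightarrow> y \<in> I \<Longrightarrow> x + y \<in> I"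
  and ideal_of_mult: "ideal_of I A \<Longrightarrow> a \<in> A \<Longrightarrow> x \<in> I \<Longrightarrow> a * x \<in> I"
  and ideal_of_mult_right: "ideal_of I A \<Longrightarrow> a \<in> A \<Longrightarrow> x \<in> I \<Longrightarrow> x * a \<in> I"
  by (auto simp: ideal_of_def mult.commute)

lemma ideal_of_uminus: "ideal_of I A \<Longrightarrow> subring_set A \<Longrightarrow> x \<in> I \<Longrightarrow> - x \<in> I"
  using ideal_of_mult[of I A "-1" x] subring_set_uminus[of A 1] by simp

lemma ideal_of_diff: "ideal_of I A \<Longrightarrow> subring_set A \<Longrightarrow> x \<in> I \<Longrightarrow> y \<in> I \<Longrightarrow> x - y \<in> I"
  using ideal_of_add[of I A x "-y"] ideal_of_uminus[of I A y] by simp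

lemma ideal_of_sum: "ideal_of I A \<Longrightarrow> (\<And>i. i \<in> S \<Longrightarrow> f i \<in> I) \<Longrightarrow> sum f S \<in> I"
  by (induction S rule: infinite_finite_induct) (auto intro: ideal_of_add)

text \<open>The unit ideal. Rules stated for ideals thereby also serve for polynomials with
  coefficients in the subring itself.\<close>

lemma ideal_of_self: "subring_set A \<Longrightarrow> ideal_of A A"
  by (auto simp: ideal_of_def subring_set_closed)

lemma subring_set_prod: "subring_set A \<Longrightarrow> (\<And>i. i \<in> S \<Longrightarrow> f i \<in> A) \<Longrightarrow> prod f S \<in> A"
  by (induction S rule: infinite_finite_induct) (auto intro: subring_set_mult)

definition prime_of :: "'a::comm_ring_1 set \<Rightarrow> 'a set \<Rightarrow> bool" where
  "prime_of P A \<longleftrightarrow> ideal_of P A \<and> 1 \<notin> P \<and> (\<forall>a\<in>A. \<forall>b\<in>A. a * b \<in> P \<longrightarrow> a \<in> P \<or> b \<in> P)"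

lemma prime_of_ideal: "prime_of P A \<Longrightarrow> ideal_of P A"
  and prime_of_one: "prime_of P A \<Longrightarrow> 1 \<notin> P"
  and prime_of_mult: "prime_of P A \<Longrightarrow> a \<in> A \<Longrightarrow> b \<in> A \<Longrightarrow> a * b \<in> P \<Longrightarrow> a \<in> P \<or> b \<in> P"
  by (auto simp: prime_of_def)

lemma prime_of_prod:
  "prime_of P A \<Longrightarrow> subring_set A \<Longrightarrow> (\<And>i. i \<in> S \<Longrightarrow> f i \<in> A - P) \<Longrightarrow> prod f S \<in> A - P"
proof (induction S rule: infinite_finite_induct)
  case (insert i S)
  then have "f i \<in> A - P" "prod f S \<in> A - P"
    by auto
  with insert show ?case
    using prime_of_mult[of P A "f i" "prod f S"] subring_set_mult[of A "f i" "prod f S"] by auto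
qed (auto simp: prime_of_one)

lemma prime_of_restrict:
  assumes "prime_of P A" "subring_set A" "subring_set B" "B \<subseteq> A"
  shows "prime_of (P \<inter> B) B"
  using assms unfolding prime_of_def ideal_of_def
  by (simp add: subring_set_closed) blast

section \<open>Polynomials with coefficients in a subring or an ideal\<close>

definition poly_over :: "'a::comm_ring_1 set \<Rightarrow> 'a poly set" where
  "poly_over D = {p. \<forall>i. coeff p i \<in> D}"

lemma poly_over_mono: "p \<in> poly_over D \<Longrightarrow> D \<subseteq> E \<Longrightarrow> p \<in> poly_over E"
  by (auto simp: poly_over_def)

lemma poly_over_coeff: "p \<in> poly_over D \<Longrightarrow> coeff p i \<in> D"
  by (auto simp: poly_over_def)

lemma poly_over_zero [simp]: "0 \<in> D \<Longrightarrow> 0 \<in> poly_over D"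
  by (simp add: poly_over_def)

lemma poly_over_pCons: "pCons a p \<in> poly_over D \<longleftrightarrow> a \<in> D \<and> p \<in> poly_over D"
  by (auto simp: poly_over_def coeff_pCons split: nat.splits)

lemma poly_over_monom: "0 \<in> D \<Longrightarrow> a \<in> D \<Longrightarrow> monom a n \<in> poly_over D"
  by (simp add: poly_over_def)

lemma poly_over_add: "ideal_of D A \<Longrightarrow> p \<in> poly_over D \<Longrightarrow> q \<in> poly_over D \<Longrightarrow> p + q \<in> poly_over D"
  by (auto simp: poly_over_def ideal_of_add)

lemma poly_over_diff:
  "ideal_of D A \<Longrightarrow> subring_set A \<Longrightarrow> p \<in> poly_over D \<Longrightarrow> q \<in> poly_over D \<Longrightarrow> p - q \<in> poly_over D"
  by (auto simp: poly_over_def ideal_of_diff)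

lemma poly_over_mult:
  "ideal_of I A \<Longrightarrow> p \<in> poly_over A \<Longrightarrow> q \<in> poly_over I \<Longrightarrow> p * q \<in> poly_over I"
  by (auto simp: poly_over_def coeff_mult intro!: ideal_of_sum ideal_of_mult)

lemma poly_over_smult: "ideal_of I A \<Longrightarrow> a \<in> A \<Longrightarrow> q \<in> poly_over I \<Longrightarrow> smult a q \<in> poly_over I"
  by (auto simp: poly_over_def intro!: ideal_of_mult)

lemma poly_over_smult': "ideal_of I A \<Longrightarrow> a \<in> I \<Longrightarrow> q \<in> poly_over A \<Longrightarrow> smult a q \<in> poly_over I"
  by (auto simp: poly_over_def intro!: ideal_of_mult_right)

lemma poly_over_reflect: "0 \<in> D \<Longrightarrow> q \<in> poly_over D \<Longrightarrow> reflect_poly q \<in> poly_over D"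
  by (auto simp: poly_over_def coeff_reflect_poly)

lemma poly_over_eval:
  "ideal_of I A \<Longrightarrow> p \<in> poly_over I \<Longrightarrow> subring_set A \<Longrightarrow> x \<in> A \<Longrightarrow> poly p x \<in> I"
  unfolding poly_altdef by (intro ideal_of_sum ideal_of_mult_right subring_set_power poly_over_coeff)

definition adjoin :: "'a::comm_ring_1 set \<Rightarrow> 'a \<Rightarrow> 'a set" where
  "adjoin D x = (\<lambda>p. poly p x) ` poly_over D"

lemma adjoinI: "p \<in> poly_over D \<Longrightarrow> poly p x \<in> adjoin D x"
  by (simp add: adjoin_def)

lemma subset_adjoin: "0 \<in> D \<Longrightarrow> D \<subseteq> adjoin D x"
proof
  fix d assume "0 \<in> D" "d \<in> D"
  then have "[:d:] \<in> poly_over D"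
    by (simp add: poly_over_pCons)
  from adjoinI[OF this, of x] show "d \<in> adjoin D x"
    by simp
qed

lemma self_adjoin: "subring_set D \<Longrightarrow> x \<in> adjoin D x"
  using adjoinI[of "[:0, 1:]" D x] by (simp add: poly_over_pCons)

lemma subring_set_adjoin: "subring_set D \<Longrightarrow> subring_set (adjoin D x)"
  unfolding subring_set_def[of "adjoin D x"]
proof (intro conjI ballI)
  assume D: "subring_set D"
  then show "1 \<in> adjoin D x"
    using subset_adjoin[of D x] by auto
  fix y z assume "y \<in> adjoin D x" "z \<in> adjoin D x"
  then obtain p q where pq: "p \<in> poly_over D" "q \<in> poly_over D" "y = poly p x" "z = poly q x"
    by (auto simp: adjoin_def)
  have "poly (p - q) x \<in> adjoin D x" "poly (p * q) x \<in> adjoin D x"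
    using pq(1,2) D ideal_of_self[OF D] by (blast intro: adjoinI poly_over_diff poly_over_mult)+
  then show "y - z \<in> adjoin D x" "y * z \<in> adjoin D x"
    using pq by auto
qed

lemma adjoin_subset: "subring_set B \<Longrightarrow> D \<subseteq> B \<Longrightarrow> x \<in> B \<Longrightarrow> adjoin D x \<subseteq> B"
  using poly_over_eval[OF ideal_of_self[of B]] poly_over_mono[of _ D B] by (force simp: adjoin_def)

section \<open>Chevalley's extension theorem\<close>

text \<open>Since \<open>inverse 0 = 0\<close> in a field type, zero has to be listed
  separately.\<close>

definition nonunits :: "'a::field set \<Rightarrow> 'a set" where
  "nonunits V = {x \<in> V. x = 0 \<or> inverse x \<notin> V}"

text \<open>A ring is local exactly when its nonunits are closed under addition; they then form the
  maximal ideal.\<close>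

definition local_subring :: "'a::field set \<Rightarrow> bool" where
  "local_subring V \<longleftrightarrow> subring_set V \<and> (\<forall>x\<in>nonunits V. \<forall>y\<in>nonunits V. x + y \<in> nonunits V)"

lemma local_subring_subring: "local_subring V \<Longrightarrow> subring_set V"
  by (simp add: local_subring_def)

lemma nonunits_subset: "x \<in> nonunits V \<Longrightarrow> x \<in> V"
  by (simp add: nonunits_def)

lemma unit_inverse: "x \<in> V \<Longrightarrow> x \<notin> nonunits V \<Longrightarrow> inverse x \<in> V"
  and unit_nonzero: "x \<in> V \<Longrightarrow> x \<notin> nonunits V \<Longrightarrow> x \<noteq> 0"
  by (auto simp: nonunits_def)

lemma inverse_unit: "x \<in> V \<Longrightarrow> x \<notin> nonunits V \<Longrightarrow> inverse x \<notin> nonunits V"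
  by (auto simp: nonunits_def)

lemma zero_nonunits: "subring_set V \<Longrightarrow> 0 \<in> nonunits V"
  by (simp add: nonunits_def)

lemma one_nonunits: "1 \<notin> nonunits V"
  by (simp add: nonunits_def)

lemma nonunits_mult:
  assumes "subring_set V" "a \<in> V" "x \<in> nonunits V"
  shows "a * x \<in> nonunits V"
proof -
  have "inverse x \<in> V" if "inverse (a * x) \<in> V" "a * x \<noteq> 0"
    using subring_set_mult[OF assms(1) that(1) assms(2)] that(2)
    by (simp add: field_simps)
  with assms show ?thesis
    by (auto simp: nonunits_def subring_set_closed)
qed

lemma nonunits_prime_of: "local_subring V \<Longrightarrow> prime_of (nonunits V) V"
  unfolding prime_of_def ideal_of_def
  by (auto simp: nonunits_subset zero_nonunits one_nonunits nonunits_mult local_subring_def)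
     (auto simp: nonunits_def subring_set_closed)

lemmas nonunits_ideal_of = prime_of_ideal[OF nonunits_prime_of]

lemma local_subring_UNIV [simp]: "local_subring UNIV"
  by (auto simp: local_subring_def nonunits_def)

lemma nonunits_UNIV [simp]: "nonunits UNIV = {0::'a::field}"
  by (auto simp: nonunits_def)

text \<open>
  The preimages in \<open>V\<^sub>0\<close> of the valuation rings of the residue field of a local ring \<open>V\<^sub>0\<close>.
  For \<open>V\<^sub>0 = UNIV\<close> these are the valuation rings of the ambient field.
\<close>

definition val_in :: "'a::field set \<Rightarrow> 'a set \<Rightarrow> bool" where
  "val_in V\<^sub>0 V \<longleftrightarrow> subring_set V \<and> nonunits V\<^sub>0 \<subseteq> V \<and> V \<subseteq> V\<^sub>0 \<and>
     (\<forall>x \<in> V\<^sub>0 - nonunits V\<^sub>0. x \<in> V \<or> inverse x \<in> V)"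

lemma val_in_subring: "val_in V\<^sub>0 V \<Longrightarrow> subring_set V"
  and val_in_subset: "val_in V\<^sub>0 V \<Longrightarrow> V \<subseteq> V\<^sub>0"
  by (auto simp: val_in_def)

lemma val_in_nonunits: "val_in V\<^sub>0 V \<Longrightarrow> nonunits V\<^sub>0 \<subseteq> nonunits V"
  by (auto simp: val_in_def nonunits_def)

lemma val_in_UNIV: "val_in UNIV V \<longleftrightarrow> subring_set V \<and> (\<forall>x. x \<in> V \<or> inverse x \<in> V)"
  by (auto simp: val_in_def)

text \<open>If one of \<open>x / y\<close>, \<open>y / x\<close> lies in \<open>V\<close>, then
  \<open>x + y = (x / y + 1) * y\<close>, or the same with \<open>x\<close> and \<open>y\<close>
  exchanged, is a multiple of a nonunit. Neither ratio need lie in \<open>V\<close> only when both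
  elements are nonunits of \<open>V\<^sub>0\<close>, and then locality of \<open>V\<^sub>0\<close>
  is enough.\<close>

lemma val_in_local:
  assumes V0: "local_subring V\<^sub>0" and V: "val_in V\<^sub>0 V"
  shows "local_subring V"
  unfolding local_subring_def
proof (intro conjI ballI)
  note sub = val_in_subring[OF V]
  show "subring_set V" by (rule sub)
  have key: "x + y \<in> nonunits V"
    if "x \<in> nonunits V" "y \<in> nonunits V" "x / y \<in> V" for x y
  proof (rule ccontr)
    assume n: "x + y \<notin> nonunits V"
    have "(x / y + 1) * y \<in> nonunits V"
      using that sub by (intro nonunits_mult) (auto simp: subring_set_closed)
    moreover have "y \<noteq> 0"
      using that(1) n by auto
    ultimately show False
      using n by (simp add: distrib_right)
  qed
  fix x y assume x: "x \<in> nonunits V" and y: "y \<in> nonunits V"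
  show "x + y \<in> nonunits V"
  proof (cases "x = 0 \<or> y = 0")
    case False
    have sub0: "subring_set V\<^sub>0"
      using V0 by (rule local_subring_subring)
    have *: "x / y \<in> V \<or> y / x \<in> V"
      if "y \<in> nonunits V" "x \<in> nonunits V" "y \<notin> nonunits V\<^sub>0" "x \<noteq> 0" "y \<noteq> 0" for x y
    proof (cases "x \<in> nonunits V\<^sub>0")
      case True
      have "inverse y \<in> V\<^sub>0"
        using that unit_inverse val_in_subset[OF V] nonunits_subset[of y V] by blast
      then have "inverse y * x \<in> nonunits V\<^sub>0"
        using True sub0 by (intro nonunits_mult)
      then show ?thesis
        using V by (auto simp: val_in_def field_simps)
    next
      case False
      have xy: "x \<in> V\<^sub>0" "y \<in> V\<^sub>0"
        using that val_in_subset[OF V] nonunits_subset by blast+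
      then have "x / y \<in> V\<^sub>0" "inverse (x / y) \<in> V\<^sub>0"
        using that False unit_inverse sub0
        by (auto simp: divide_inverse intro!: subring_set_mult)
      then have "x / y \<in> V\<^sub>0 - nonunits V\<^sub>0"
        using that by (auto simp: nonunits_def)
      then have "x / y \<in> V \<or> inverse (x / y) \<in> V"
        using V unfolding val_in_def by blast
      then show ?thesis by simp
    qed
    show ?thesis
    proof (cases "x \<in> nonunits V\<^sub>0 \<and> y \<in> nonunits V\<^sub>0")
      case True
      then have "x + y \<in> nonunits V\<^sub>0"
        using V0 by (auto simp: local_subring_def)
      then show ?thesis
        using val_in_nonunits[OF V] by auto
    next
      case nn: False
      then have "x / y \<in> V \<or> y / x \<in> V"
        using *[of y x] *[of x y] x y False by blast
      then show ?thesis
        using key[of x y] key[of y x] x y by (auto simp: add.commute)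
    qed
  qed (use x y in auto)
qed

text \<open>The ideal of \<open>B\<close> generated by \<open>J\<close>, built one summand at a
  time. Membership involves finitely many elements of \<open>B\<close>, so it descends from the
  union of a chain to a member of the chain.\<close>

inductive_set ideal_gen :: "'a::comm_ring_1 set \<Rightarrow> 'a set \<Rightarrow> 'a set" for J B where
  zero: "0 \<in> ideal_gen J B"
| step: "x \<in> ideal_gen J B \<Longrightarrow> j \<in> J \<Longrightarrow> b \<in> B \<Longrightarrow> x + j * b \<in> ideal_gen J B"

lemma ideal_gen_ideal:
  assumes "subring_set B" "J \<subseteq> B"
  shows "ideal_of (ideal_gen J B) B"
  unfolding ideal_of_def
proof (intro conjI ballI subsetI)
  fix x assume "x \<in> ideal_gen J B"
  then show "x \<in> B"
    using assms by induction (auto simp: subring_set_closed subset_iff)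
next
  show "0 \<in> ideal_gen J B" by (rule ideal_gen.zero)
next
  fix x y assume "x \<in> ideal_gen J B" "y \<in> ideal_gen J B"
  from this(2,1) show "x + y \<in> ideal_gen J B"
    by induction (auto simp: add.assoc[symmetric] intro: ideal_gen.step)
next
  fix a x assume "a \<in> B" and "x \<in> ideal_gen J B"
  from this(2) show "a * x \<in> ideal_gen J B"
  proof induction
    case (step x j b)
    then have "a * x + j * (a * b) \<in> ideal_gen J B"
      using assms \<open>a \<in> B\<close> by (intro ideal_gen.step) (auto simp: subring_set_closed)
    then show ?case
      by (simp add: algebra_simps)
  qed (simp add: ideal_gen.zero)
qed

lemma ideal_gen_incl: "1 \<in> B \<Longrightarrow> J \<subseteq> ideal_gen J B"
  using ideal_gen.step[OF ideal_gen.zero, of _ J 1 B] by auto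

lemma ideal_gen_least: "ideal_of I B \<Longrightarrow> J \<subseteq> I \<Longrightarrow> x \<in> ideal_gen J B \<Longrightarrow> x \<in> I"
  by (rotate_tac 2, induction rule: ideal_gen.induct)
     (auto intro!: ideal_of_add ideal_of_mult_right)

lemma ideal_gen_mono: "B \<subseteq> B' \<Longrightarrow> x \<in> ideal_gen J B \<Longrightarrow> x \<in> ideal_gen J B'"
  by (rotate_tac, induction rule: ideal_gen.induct) (auto intro: ideal_gen.intros)

lemma ideal_gen_chain:
  assumes "x \<in> ideal_gen J (\<Union>C)" "\<And>B B'. B \<in> C \<Longrightarrow> B' \<in> C \<Longrightarrow> B \<subseteq> B' \<or> B' \<subseteq> B" "C \<noteq> {}"
  shows "\<exists>B\<in>C. x \<in> ideal_gen J B"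
  using assms(1)
proof induction
  case zero
  then show ?case using assms(3) ideal_gen.zero by auto
next
  case (step x j b)
  then obtain B B' where "B \<in> C" "B' \<in> C" "x \<in> ideal_gen J B" "b \<in> B'"
    by blast
  then have "\<exists>B\<in>C. x \<in> ideal_gen J B \<and> b \<in> B"
    using assms(2)[of B B'] ideal_gen_mono[of B B' x J] by blast
  then show ?case
    using step(2) ideal_gen.step by blast
qed

text \<open>Collecting powers of \<open>x\<close> turns membership into a polynomial expression with
  coefficients in the ideal of \<open>B\<close>.\<close>

lemma ideal_gen_adjoin:
  assumes "y \<in> ideal_gen J (adjoin B x)" "subring_set B" "J \<subseteq> B"
  shows "\<exists>p \<in> poly_over (ideal_gen J B). y = poly p x"
  using assms(1)
proof induction
  case zero
  then show ?case
    by (intro bexI[of _ 0]) (auto simp: ideal_gen.zero)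
next
  case (step y j b)
  then obtain p q where pq: "p \<in> poly_over (ideal_gen J B)" "y = poly p x" "q \<in> poly_over B" "b = poly q x"
    by (auto simp: adjoin_def)
  have I: "ideal_of (ideal_gen J B) B"
    using assms by (intro ideal_gen_ideal)
  have "j \<in> ideal_gen J B"
    using ideal_gen_incl[of B J] assms step by auto
  then have "p + smult j q \<in> poly_over (ideal_gen J B)"
    using I pq by (intro poly_over_add poly_over_smult')
  moreover have "y + j * b = poly (p + smult j q) x"
    using pq by simp
  ultimately show ?case by blast
qed

text \<open>The second relation reads \<open>1 - d = inverse x * poly q1 (inverse x)\<close>.
  Multiplied by \<open>x ^ n\<close> it expresses \<open>(1 - d) * x ^ n\<close> through lower
  powers of \<open>x\<close> with coefficients in \<open>I\<close>, and this replaces the top term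
  in \<open>1 - d\<close> times the first relation.\<close>

lemma unit_relation_reduce:
  fixes x :: "'a::field"
  assumes B: "subring_set B" and I: "ideal_of I B" and x: "x \<noteq> 0"
    and p: "p \<in> poly_over I" "poly p x = 1" and q: "q \<in> poly_over I" "poly q (inverse x) = 1"
    and deg: "degree q \<le> degree p" "degree p > 0"
  shows "\<exists>p' \<in> poly_over I. poly p' x = 1 \<and> degree p' < degree p"
proof -
  define n where "n = degree p"
  define c where "c = coeff p n"
  obtain d q1 where q_eq: "q = pCons d q1" by (cases q)
  define p1 where "p1 = p - monom c n"
  \<comment> \<open>Reversing \<open>q1\<close> and padding gives the value
    \<open>x ^ (n - 1) * poly q1 (inverse x)\<close> at \<open>x\<close>, a polynomial expression of
    degree below \<open>n\<close>.\<close>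
  define q2 where "q2 = monom 1 (n - 1 - degree q1) * reflect_poly q1"
  define p' where "p' = [:d:] + smult (1 - d) p1 + smult c q2"
  have dI: "d \<in> I" and q1: "q1 \<in> poly_over I"
    using q by (auto simp: q_eq poly_over_pCons)
  have dB: "1 - d \<in> B" and cB: "c \<in> B"
    using dI ideal_of_subset[OF I] B p(1) by (auto simp: c_def subring_set_closed poly_over_coeff)
  have p1: "p1 \<in> poly_over I"
    using p I B unfolding p1_def c_def
    by (intro poly_over_diff poly_over_monom) (auto simp: poly_over_coeff)
  have "reflect_poly q1 \<in> poly_over I"
    using q1 I by (intro poly_over_reflect) auto
  then have q2: "q2 \<in> poly_over I"
    unfolding q2_def using I B by (intro poly_over_mult poly_over_monom) auto
  have "p' \<in> poly_over I"
    unfolding p'_def using I dI dB cB p1 q2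
    by (intro poly_over_add poly_over_smult) (auto simp: poly_over_pCons)
  moreover have "degree p' < n"
  proof -
    have "degree p1 < n"
      using deg degree_monom_le[of c n] unfolding p1_def c_def n_def
      by (metis Polynomial.degree_diff_le Polynomial.coeff_diff coeff_monom degree_less_if_less_eqI
          diff_self le_refl linorder_not_less leading_coeff_0_iff degree_0 order_le_imp_less_or_eq)
    moreover have "degree q2 < n"
    proof -
      have "degree q1 \<le> n - 1"
        using deg by (cases "q1 = 0") (auto simp: q_eq n_def)
      then have "n - 1 - degree q1 + degree (reflect_poly q1) \<le> n - 1"
        using degree_reflect_poly_le[of q1] by linarith
      then have "degree q2 \<le> n - 1"
        unfolding q2_def using degree_mult_le[of "monom 1 (n - 1 - degree q1)" "reflect_poly q1"]
          degree_monom_le[of "1::'a" "n - 1 - degree q1"] by linarith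
      then show ?thesis
        using deg by (simp add: n_def)
    qed
    ultimately have "degree (smult (1 - d) p1) < n" "degree (smult c q2) < n"
      using deg by (auto intro: le_less_trans[OF degree_smult_le])
    then show ?thesis
      unfolding p'_def using deg by (intro degree_add_less) (auto simp: n_def)
  qed
  moreover have "poly p' x = 1"
  proof -
    have p1x: "poly p1 x = 1 - c * x ^ n"
      by (simp add: p1_def p poly_monom)
    have "degree q1 \<le> n - 1"
      using deg by (cases "q1 = 0") (auto simp: q_eq n_def)
    then have "poly q2 x = x ^ (n - 1) * poly q1 (inverse x)"
      using x by (cases n) (auto simp: q2_def poly_monom poly_reflect_poly_nz simp flip: power_add)
    also have "\<dots> = x ^ n * (inverse x * poly q1 (inverse x))"
      using x deg by (cases n) (auto simp: n_def)
    also have "inverse x * poly q1 (inverse x) = 1 - d"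
      using q(2) by (simp add: q_eq algebra_simps)
    finally have q2x: "poly q2 x = x ^ n * (1 - d)" .
    show ?thesis
      by (simp add: p'_def p1x q2x) (simp add: algebra_simps)
  qed
  ultimately show ?thesis
    unfolding n_def by blast
qed

text \<open>Infinite descent: the relation of larger degree can always be shortened, with
  \<open>x\<close> and \<open>inverse x\<close> in exchanged roles if need be, and a relation of
  degree zero would put \<open>1\<close> into \<open>I\<close>.\<close>

lemma no_unit_relation:
  fixes x :: "'a::field"
  assumes B: "subring_set B" and I: "ideal_of I B" "1 \<notin> I"
  shows "x \<noteq> 0 \<Longrightarrow> p \<in> poly_over I \<Longrightarrow> poly p x = 1 \<Longrightarrow> q \<in> poly_over I \<Longrightarrow>
    poly q (inverse x) = 1 \<Longrightarrow> False"
proof (induction "degree p + degree q" arbitrary: p q x rule: less_induct)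
  case less
  have pos: "degree p > 0" if "p \<in> poly_over I" "poly p x = 1" for p and x :: 'a
  proof (rule ccontr)
    assume "\<not> degree p > 0"
    then obtain c where "p = [:c:]"
      by (auto elim: degree_eq_zeroE)
    with that I show False
      by (auto simp: poly_over_pCons)
  qed
  show False
  proof (cases "degree q \<le> degree p")
    case True
    then obtain p' where "p' \<in> poly_over I" "poly p' x = 1" "degree p' < degree p"
      using unit_relation_reduce[OF B I(1) less(2-6)] pos[OF less(3,4)] by auto
    then show False
      using less.hyps[of p' q x] less.prems by auto
  next
    case False
    then obtain q' where "q' \<in> poly_over I" "poly q' (inverse x) = 1" "degree q' < degree q"
      using unit_relation_reduce[OF B I(1), of "inverse x" q p] pos[OF less(5,6)] less.prems by auto
    then show False
      using less.hyps[of p q' x] less.prems by auto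
  qed
qed

text \<open>Zorn's lemma for the subrings between \<open>A\<close> and \<open>V\<^sub>0\<close> in
  which \<open>J\<close> generates a proper ideal. If a maximal one contained neither
  \<open>x\<close> nor \<open>inverse x\<close>, adjoining either would make the ideal improper,
  which gives the two relations excluded by \<open>no_unit_relation\<close>.\<close>

lemma chevalley:
  assumes V0: "local_subring V\<^sub>0" and A: "subring_set A" "A \<subseteq> V\<^sub>0"
    and J: "ideal_of J A" "nonunits V\<^sub>0 \<subseteq> J" "1 \<notin> J"
  obtains V where "val_in V\<^sub>0 V" "A \<subseteq> V" "J \<subseteq> nonunits V"
proof -
  define S where "S = {B. subring_set B \<and> A \<subseteq> B \<and> B \<subseteq> V\<^sub>0 \<and> 1 \<notin> ideal_gen J B}"
  have JA: "J \<subseteq> A"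
    using J by (auto simp: ideal_of_def)
  have "\<exists>M\<in>S. \<forall>Y\<in>S. M \<subseteq> Y \<longrightarrow> Y = M"
  proof (rule subset_Zorn_nonempty)
    have "A \<in> S"
      using A J ideal_gen_least[OF J(1)] by (auto simp: S_def)
    then show "S \<noteq> {}" by auto
    fix C assume C: "C \<noteq> {}" "subset.chain S C"
    then have CA: "C \<subseteq> S" and lin: "\<And>B B'. B \<in> C \<Longrightarrow> B' \<in> C \<Longrightarrow> B \<subseteq> B' \<or> B' \<subseteq> B"
      by (auto simp: subset_chain_def)
    have "subring_set (\<Union>C)"
      unfolding subring_set_def
    proof (intro conjI ballI)
      show "1 \<in> \<Union>C"
      proof -
        obtain B where "B \<in> C" "subring_set B"
          using C CA by (auto simp: S_def)
        then show ?thesis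
          using subring_set_one by blast
      qed
      fix x y assume "x \<in> \<Union>C" "y \<in> \<Union>C"
      then obtain B where "B \<in> C" "x \<in> B" "y \<in> B"
        using lin by blast
      moreover from this have "subring_set B"
        using CA by (auto simp: S_def)
      ultimately show "x - y \<in> \<Union>C" "x * y \<in> \<Union>C"
        by (auto intro: subring_set_closed)
    qed
    moreover have "A \<subseteq> \<Union>C" "\<Union>C \<subseteq> V\<^sub>0"
      using C CA by (auto simp: S_def subset_iff)
    moreover have "1 \<notin> ideal_gen J (\<Union>C)"
      using ideal_gen_chain[OF _ lin C(1), of 1 J] CA by (auto simp: S_def)
    ultimately show "\<Union>C \<in> S"
      by (simp add: S_def)
  qed
  then obtain B where BA: "B \<in> S" and max: "\<And>Y. Y \<in> S \<Longrightarrow> B \<subseteq> Y \<Longrightarrow> Y = B"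
    by blast
  then have B: "subring_set B" "A \<subseteq> B" "B \<subseteq> V\<^sub>0" "1 \<notin> ideal_gen J B"
    by (auto simp: S_def)
  have JB: "J \<subseteq> B"
    using JA B by blast
  have I: "ideal_of (ideal_gen J B) B"
    using B JB by (intro ideal_gen_ideal)
  have rel: "\<exists>p \<in> poly_over (ideal_gen J B). poly p x = 1" if "x \<in> V\<^sub>0" "x \<notin> B" for x
  proof -
    have "B \<subseteq> adjoin B x" "x \<in> adjoin B x" "subring_set (adjoin B x)" "adjoin B x \<subseteq> V\<^sub>0"
      using B that subset_adjoin[of B x] self_adjoin subring_set_adjoin
        adjoin_subset[OF local_subring_subring[OF V0], of B x] by auto
    moreover from this that have "adjoin B x \<notin> S"
      using max[of "adjoin B x"] by auto
    ultimately have "1 \<in> ideal_gen J (adjoin B x)"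
      using B by (auto simp: S_def)
    then show ?thesis
      using ideal_gen_adjoin[OF _ B(1) JB] by metis
  qed
  have "x \<in> B \<or> inverse x \<in> B" if "x \<in> V\<^sub>0 - nonunits V\<^sub>0" for x
    using no_unit_relation[OF B(1) I B(4), of x] rel[of x] rel[of "inverse x"] that
      unit_inverse[of x V\<^sub>0] unit_nonzero[of x V\<^sub>0] by blast
  then have "val_in V\<^sub>0 B"
    unfolding val_in_def using B J JB by blast
  moreover have "J \<subseteq> nonunits B"
  proof
    fix j assume "j \<in> J"
    then have j: "j \<in> ideal_gen J B" "j \<in> B"
      using ideal_gen_incl[of B J] B JB by auto
    show "j \<in> nonunits B"
      using j ideal_of_mult[OF I, of "inverse j" j] B(4) by (auto simp: nonunits_def)
  qed
  ultimately show ?thesis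
    using that B by blast
qed

section \<open>Algebraic dependence through valuations\<close>

text \<open>
  The last condition says that \<open>V\<close> is trivial on the image of \<open>D\<close> in the residue field of \<open>V\<^sub>0\<close>,
  so that \<open>D\<close> can be used in place of the subfield which its image generates.
\<close>

definition vals :: "'a::field set \<Rightarrow> 'a set \<Rightarrow> 'a set set" where
  "vals V\<^sub>0 D = {V. val_in V\<^sub>0 V \<and> D \<subseteq> V \<and> nonunits V \<inter> D \<subseteq> nonunits V\<^sub>0}"

text \<open>The image of \<open>b\<close> in the residue field of \<open>V\<^sub>0\<close> is
  algebraic over the fraction field of the image of \<open>D\<close>: some polynomial over
  \<open>D\<close> with nonzero reduction vanishes there.\<close>

definition algebraic_mod :: "'a::field set \<Rightarrow> 'a set \<Rightarrow> 'a \<Rightarrow> bool" where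
  "algebraic_mod V\<^sub>0 D b \<longleftrightarrow>
     (\<exists>p \<in> poly_over D. (\<exists>i. coeff p i \<notin> nonunits V\<^sub>0) \<and> poly p b \<in> nonunits V\<^sub>0)"

lemma vals_antimono: "V \<in> vals V\<^sub>0 E \<Longrightarrow> D \<subseteq> E \<Longrightarrow> V \<in> vals V\<^sub>0 D"
  by (auto simp: vals_def)

text \<open>Let \<open>F\<close> be the fraction field of the image of \<open>D\<close> in the
  residue field of \<open>V\<^sub>0\<close>. Either \<open>q(y)\<close> is a unit of
  \<open>F[y]\<close>, which is the second alternative with denominators cleared, or it generates a
  proper ideal and Chevalley's theorem supplies a place where it vanishes.\<close>

lemma exists_val_or_inverse:
  assumes V0: "local_subring V\<^sub>0" and D: "subring_set D" "D \<subseteq> V\<^sub>0"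
    and y: "y \<in> V\<^sub>0" and q: "q \<in> poly_over D"
  shows "(\<exists>V \<in> vals V\<^sub>0 D. y \<in> V \<and> poly q y \<in> nonunits V) \<or>
         (\<exists>d \<in> D - nonunits V\<^sub>0. \<exists>p \<in> poly_over D. d - poly q y * poly p y \<in> nonunits V\<^sub>0)"
proof (rule disjCI)
  let ?m = "nonunits V\<^sub>0" and ?w = "poly q y"
  assume neg: "\<not> (\<exists>d \<in> D - ?m. \<exists>p \<in> poly_over D. d - ?w * poly p y \<in> ?m)"
  note sub = local_subring_subring[OF V0] and m = nonunits_prime_of[OF V0]
  note mi = prime_of_ideal[OF m] and Di = ideal_of_self[OF D(1)]
  \<comment> \<open>\<open>A\<close> is the preimage of \<open>F[y]\<close> in
    \<open>V\<^sub>0\<close> and \<open>J\<close> that of the ideal generated by \<open>?w\<close>;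
    the factor \<open>d\<close> clears denominators.\<close>
  define A where "A = {x \<in> V\<^sub>0. \<exists>d \<in> D - ?m. \<exists>p \<in> poly_over D. d * x - poly p y \<in> ?m}"
  define J where "J = {x \<in> V\<^sub>0. \<exists>d \<in> D - ?m. \<exists>p \<in> poly_over D. d * x - ?w * poly p y \<in> ?m}"
  have ev: "poly p y \<in> V\<^sub>0" if "p \<in> poly_over D" for p
    using that D y sub poly_over_mono by (blast intro: poly_over_eval[OF ideal_of_self])
  have Dm: "d * d' \<in> D - ?m" if "d \<in> D - ?m" "d' \<in> D - ?m" for d d'
    using that D prime_of_mult[OF m, of d d'] by (auto intro: subring_set_mult)
  have one: "1 \<in> D - ?m"
    using D by (simp add: one_nonunits)
  have comb: "a * u + b * v \<in> ?m" if "a \<in> V\<^sub>0" "b \<in> V\<^sub>0" "u \<in> ?m" "v \<in> ?m" for a b u v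
    using that mi by (intro ideal_of_add ideal_of_mult)
  have polyA: "poly p y \<in> A" if "p \<in> poly_over D" for p
    using that one ev zero_nonunits[OF sub] unfolding A_def by (auto intro!: bexI[of _ 1] bexI[of _ p])
  have DA: "D \<subseteq> A"
  proof
    fix d assume "d \<in> D"
    then show "d \<in> A"
      using polyA[of "[:d:]"] D by (simp add: poly_over_pCons)
  qed
  have mJ: "?m \<subseteq> J"
  proof
    fix x assume "x \<in> ?m"
    then have "1 * x - ?w * poly 0 y \<in> ?m" "0 \<in> poly_over D" "x \<in> V\<^sub>0"
      using D by (auto simp: nonunits_subset)
    then show "x \<in> J"
      unfolding J_def using one by blast
  qed
  have A: "subring_set A"
    unfolding subring_set_def
  proof (intro conjI ballI)
    show "1 \<in> A"
      using DA D by auto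
    fix x x' assume "x \<in> A" "x' \<in> A"
    then obtain d p d' p' where x: "x \<in> V\<^sub>0" "d \<in> D - ?m" "p \<in> poly_over D" "d * x - poly p y \<in> ?m"
      and x': "x' \<in> V\<^sub>0" "d' \<in> D - ?m" "p' \<in> poly_over D" "d' * x' - poly p' y \<in> ?m"
      unfolding A_def by blast
    have dV: "d \<in> V\<^sub>0" "d' \<in> V\<^sub>0"
      using x x' D by auto
    have "smult d' p - smult d p' \<in> poly_over D" "p * p' \<in> poly_over D"
      using x x' Di D by (auto intro!: poly_over_diff poly_over_smult poly_over_mult)
    moreover have "d * d' * (x - x') - poly (smult d' p - smult d p') y \<in> ?m"
    proof -
      have "d' * (d * x - poly p y) + (- d) * (d' * x' - poly p' y) \<in> ?m"
        using x x' dV sub by (intro comb) (auto intro: subring_set_uminus)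
      then show ?thesis by (simp add: algebra_simps)
    qed
    moreover have "d * d' * (x * x') - poly (p * p') y \<in> ?m"
    proof -
      have "(d * x) * (d' * x' - poly p' y) + poly p' y * (d * x - poly p y) \<in> ?m"
        using x x' dV sub ev by (intro comb) (auto intro: subring_set_mult)
      then show ?thesis by (simp add: algebra_simps)
    qed
    moreover have "x - x' \<in> V\<^sub>0" "x * x' \<in> V\<^sub>0"
      using x x' sub by (auto intro: subring_set_closed)
    ultimately show "x - x' \<in> A" "x * x' \<in> A"
      unfolding A_def using Dm[OF x(2) x'(2)] by blast+
  qed
  have "ideal_of J A"
    unfolding ideal_of_def
  proof (intro conjI ballI subsetI)
    fix x assume "x \<in> J"
    then obtain d p where x: "x \<in> V\<^sub>0" "d \<in> D - ?m" "p \<in> poly_over D" "d * x - ?w * poly p y \<in> ?m"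
      unfolding J_def by blast
    then have "q * p \<in> poly_over D" "d * x - poly (q * p) y \<in> ?m"
      using Di q by (auto intro: poly_over_mult)
    with x show "x \<in> A"
      unfolding A_def by blast
  next
    show "0 \<in> J"
      using mJ zero_nonunits[OF sub] by auto
  next
    fix x x' assume "x \<in> J" "x' \<in> J"
    then obtain d p d' p' where x: "x \<in> V\<^sub>0" "d \<in> D - ?m" "p \<in> poly_over D" "d * x - ?w * poly p y \<in> ?m"
      and x': "x' \<in> V\<^sub>0" "d' \<in> D - ?m" "p' \<in> poly_over D" "d' * x' - ?w * poly p' y \<in> ?m"
      unfolding J_def by blast
    have dV: "d \<in> V\<^sub>0" "d' \<in> V\<^sub>0"
      using x x' D by auto
    have "smult d' p + smult d p' \<in> poly_over D"
      using x x' Di D by (auto intro!: poly_over_add poly_over_smult)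
    moreover have "d * d' * (x + x') - ?w * poly (smult d' p + smult d p') y \<in> ?m"
    proof -
      have "d' * (d * x - ?w * poly p y) + d * (d' * x' - ?w * poly p' y) \<in> ?m"
        using x x' dV sub by (intro comb) auto
      then show ?thesis by (simp add: algebra_simps)
    qed
    moreover have "x + x' \<in> V\<^sub>0"
      using x x' sub by (auto intro: subring_set_closed)
    ultimately show "x + x' \<in> J"
      unfolding J_def using Dm[OF x(2) x'(2)] by blast
  next
    fix x x' assume "x \<in> A" "x' \<in> J"
    then obtain d p d' p' where x: "x \<in> V\<^sub>0" "d \<in> D - ?m" "p \<in> poly_over D" "d * x - poly p y \<in> ?m"
      and x': "x' \<in> V\<^sub>0" "d' \<in> D - ?m" "p' \<in> poly_over D" "d' * x' - ?w * poly p' y \<in> ?m"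
      unfolding A_def J_def by blast
    have dV: "d \<in> V\<^sub>0" "d' \<in> V\<^sub>0"
      using x x' D by auto
    have "p * p' \<in> poly_over D"
      using x x' Di by (auto intro!: poly_over_mult)
    moreover have "d * d' * (x * x') - ?w * poly (p * p') y \<in> ?m"
    proof -
      have "(d * x) * (d' * x' - ?w * poly p' y) + (?w * poly p' y) * (d * x - poly p y) \<in> ?m"
        using x x' dV sub ev q by (intro comb) (auto intro: subring_set_mult)
      then show ?thesis by (simp add: algebra_simps)
    qed
    moreover have "x * x' \<in> V\<^sub>0"
      using x x' sub by (auto intro: subring_set_closed)
    ultimately show "x * x' \<in> J"
      unfolding J_def using Dm[OF x(2) x'(2)] by blast
  qed
  moreover have "1 \<notin> J"
    using neg by (auto simp: J_def)
  moreover have "A \<subseteq> V\<^sub>0"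
    by (auto simp: A_def)
  ultimately obtain V where V: "val_in V\<^sub>0 V" "A \<subseteq> V" "J \<subseteq> nonunits V"
    using chevalley[OF V0 A _ _ mJ] by blast
  have "y \<in> A"
    using polyA[of "[:0, 1:]"] D by (simp add: poly_over_pCons)
  moreover have "?w \<in> J"
    unfolding J_def using one ev[OF q] D zero_nonunits[OF sub]
    by (auto simp: poly_over_pCons intro!: bexI[of _ 1] bexI[of _ "[:1:]"])
  \<comment> \<open>The denominators are units of \<open>A\<close>, so \<open>V\<close> is trivial
    on \<open>D\<close>.\<close>
  moreover have "d \<notin> nonunits V" if "d \<in> D - ?m" for d
  proof
    assume "d \<in> nonunits V"
    have "d \<noteq> 0" "inverse d \<in> V\<^sub>0"
      using that D zero_nonunits[OF sub] by (auto intro: unit_inverse)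
    then have "inverse d \<in> A"
      unfolding A_def using that D zero_nonunits[OF sub]
      by (auto simp: poly_over_pCons intro!: bexI[of _ d] bexI[of _ "[:1:]"])
    with V \<open>d \<in> nonunits V\<close> \<open>d \<noteq> 0\<close> show False
      by (auto simp: nonunits_def)
  qed
  ultimately show "\<exists>V \<in> vals V\<^sub>0 D. y \<in> V \<and> ?w \<in> nonunits V"
    using V DA by (intro bexI[of _ V]) (auto simp: vals_def)
qed

text \<open>The dichotomy for \<open>y = inverse b\<close> and the polynomial \<open>X\<close>:
  \<open>y\<close> vanishes at no place, so some nonzero \<open>d\<close> is congruent to
  \<open>y * poly p y\<close>. Reversing coefficients gives a relation for \<open>b\<close> with top
  coefficient \<open>d\<close>.\<close>

lemma algebraic_mod_if_in_all_vals:
  assumes V0: "local_subring V\<^sub>0" and D: "subring_set D" "D \<subseteq> V\<^sub>0"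
    and b: "b \<in> V\<^sub>0 - nonunits V\<^sub>0" and all: "\<And>V. V \<in> vals V\<^sub>0 D \<Longrightarrow> b \<in> V"
  shows "algebraic_mod V\<^sub>0 D b"
proof -
  let ?m = "nonunits V\<^sub>0" and ?y = "inverse b"
  note sub = local_subring_subring[OF V0]
  have b0: "b \<noteq> 0"
    using b zero_nonunits[OF sub] by auto
  have y: "?y \<in> V\<^sub>0"
    using b by (auto intro: unit_inverse)
  have "\<not> (\<exists>V \<in> vals V\<^sub>0 D. ?y \<in> V \<and> poly [:0, 1:] ?y \<in> nonunits V)"
    using all b0 by (auto simp: nonunits_def)
  moreover have "[:0, 1:] \<in> poly_over D"
    using D by (simp add: poly_over_pCons)
  ultimately obtain d p where dp: "d \<in> D - ?m" "p \<in> poly_over D" "d - ?y * poly p ?y \<in> ?m"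
    using exists_val_or_inverse[OF V0 D y, of "[:0, 1:]"] by auto
  define q where "q = pCons d (- p)"
  have "-p \<in> poly_over D"
    using dp D by (auto simp: poly_over_def intro: subring_set_uminus)
  then have q: "q \<in> poly_over D" "poly q ?y \<in> ?m"
    using dp by (auto simp: q_def poly_over_pCons)
  then have r: "reflect_poly q \<in> poly_over D"
    using D by (intro poly_over_reflect) auto
  have "poly (reflect_poly q) b \<in> ?m"
    using q b b0 sub by (auto simp: poly_reflect_poly_nz intro!: nonunits_mult subring_set_power)
  moreover have "coeff (reflect_poly q) (degree q) \<notin> ?m"
    using dp by (simp add: coeff_reflect_poly q_def)
  ultimately show ?thesis
    unfolding algebraic_mod_def using r by blast
qed

text \<open>Valuation rings are integrally closed. If \<open>b\<close> were outside
  \<open>V\<close>, then \<open>y = inverse b\<close> would be a nonunit, and multiplying the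
  relation by \<open>y ^ n\<close> would make the unit \<open>coeff p n\<close> a sum of
  nonunits.\<close>

lemma integral_in_val:
  assumes V0: "local_subring V\<^sub>0" and V: "val_in V\<^sub>0 V" and b: "b \<in> V\<^sub>0"
    and p: "p \<in> poly_over V" "poly p b \<in> nonunits V\<^sub>0"
    and n: "coeff p n \<notin> nonunits V" "\<And>i. i > n \<Longrightarrow> coeff p i \<in> nonunits V\<^sub>0"
  shows "b \<in> V"
proof (rule ccontr)
  assume nb: "b \<notin> V"
  note sub = local_subring_subring[OF V0] and mi = nonunits_ideal_of[OF V0]
  have subV: "subring_set V" and ideal: "ideal_of (nonunits V) V"
    using V val_in_subring nonunits_ideal_of val_in_local[OF V0] by auto
  have mV: "nonunits V\<^sub>0 \<subseteq> nonunits V" "V \<subseteq> V\<^sub>0"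
    using val_in_nonunits[OF V] val_in_subset[OF V] by auto
  have bn: "b \<notin> nonunits V\<^sub>0"
    using mV nb nonunits_subset by blast
  define y where "y = inverse b"
  have b0: "b \<noteq> 0"
    using nb subV by auto
  have yV0: "y \<in> V\<^sub>0"
    unfolding y_def using b bn by (rule unit_inverse)
  have y: "y \<in> nonunits V"
    using V b bn nb b0 by (auto simp: val_in_def y_def nonunits_def)
  have "n \<le> degree p"
    using n(1) zero_nonunits[OF subV] by (metis coeff_eq_0 not_le)
  then have "poly p b = (\<Sum>i<n. coeff p i * b ^ i) + coeff p n * b ^ n + (\<Sum>i\<in>{n<..degree p}. coeff p i * b ^ i)"
  proof -
    have "{..degree p} = ({..<n} \<union> {n}) \<union> {n<..degree p}"
      using \<open>n \<le> degree p\<close> by auto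
    then have "poly p b = (\<Sum>i\<in>({..<n} \<union> {n}) \<union> {n<..degree p}. coeff p i * b ^ i)"
      unfolding poly_altdef by simp
    also have "\<dots> = (\<Sum>i\<in>{..<n} \<union> {n}. coeff p i * b ^ i) + (\<Sum>i\<in>{n<..degree p}. coeff p i * b ^ i)"
      by (rule sum.union_disjoint) auto
    finally show ?thesis by simp
  qed
  moreover have "(\<Sum>i\<in>{n<..degree p}. coeff p i * b ^ i) \<in> nonunits V\<^sub>0"
    using n(2) mi b sub by (intro ideal_of_sum ideal_of_mult_right) (auto intro: subring_set_power)
  ultimately have "(\<Sum>i<n. coeff p i * b ^ i) + coeff p n * b ^ n \<in> nonunits V\<^sub>0"
    using ideal_of_diff[OF mi sub p(2)] by fastforce
  then have "y ^ n * ((\<Sum>i<n. coeff p i * b ^ i) + coeff p n * b ^ n) \<in> nonunits V"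
    using nonunits_mult[OF sub, of "y ^ n"] yV0 sub mV by (blast intro: subring_set_power)
  moreover have "y ^ n * ((\<Sum>i<n. coeff p i * b ^ i) + coeff p n * b ^ n) =
      (\<Sum>i<n. coeff p i * y ^ (n - i)) + coeff p n"
  proof -
    have "y ^ n * (coeff p i * b ^ i) = coeff p i * y ^ (n - i)" if "i \<le> n" for i
      using that b0 by (simp add: y_def power_diff power_inverse field_simps)
    note summand = this
    have "y ^ n * (coeff p n * b ^ n) = coeff p n * y ^ (n - n)"
      by (rule summand) simp
    moreover have "(\<Sum>i<n. y ^ n * (coeff p i * b ^ i)) = (\<Sum>i<n. coeff p i * y ^ (n - i))"
      by (rule sum.cong[OF refl], rule summand) simp
    ultimately show ?thesis
      unfolding diff_self_eq_0 power_0 mult_1_right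
      by (simp only: distrib_left sum_distrib_left)
  qed
  moreover have "(\<Sum>i<n. coeff p i * y ^ (n - i)) \<in> nonunits V"
  proof (intro ideal_of_sum[OF ideal] ideal_of_mult[OF ideal])
    fix i assume "i \<in> {..<n}"
    then obtain k where "n - i = Suc k"
      by (cases "n - i") auto
    moreover have "y ^ k * y \<in> nonunits V"
      using y subV by (intro nonunits_mult subring_set_power) (simp_all add: nonunits_subset)
    ultimately show "y ^ (n - i) \<in> nonunits V"
      by (simp add: mult.commute)
  qed (use p poly_over_coeff in auto)
  ultimately show False
    using n(1) ideal_of_diff[OF ideal subV] by (metis add_diff_cancel_left')
qed

text \<open>Here \<open>n\<close> is the degree of \<open>p\<close> read modulo
  \<open>M\<close>.\<close>

lemma top_coeff_outside:
  assumes "coeff p i \<notin> M" "0 \<in> M"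
  obtains n where "coeff p n \<notin> M" "\<And>i. i > n \<Longrightarrow> coeff p i \<in> M"
proof -
  define n where "n = (GREATEST n. coeff p n \<notin> M)"
  have bd: "i \<le> degree p" if "coeff p i \<notin> M" for i
    using that assms by (metis coeff_eq_0 not_le)
  have "coeff p n \<notin> M"
    unfolding n_def using assms(1) bd by (rule GreatestI_nat)
  moreover have "coeff p i \<in> M" if "i > n" for i
    using Greatest_le_nat[of "\<lambda>n. coeff p n \<notin> M" i "degree p"] bd that unfolding n_def by fastforce
  ultimately show ?thesis
    using that by blast
qed

text \<open>The leading coefficient of the reduced relation lies in \<open>D\<close>, where
  \<open>V\<close> is trivial, so it is a unit of \<open>V\<close> and \<open>b\<close> is integral
  over \<open>V\<close>.\<close>

lemma algebraic_mod_in_vals: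
  assumes V0: "local_subring V\<^sub>0" and V: "V \<in> vals V\<^sub>0 D" and b: "b \<in> V\<^sub>0" "algebraic_mod V\<^sub>0 D b"
  shows "b \<in> V"
proof -
  obtain p i where p: "p \<in> poly_over D" "coeff p i \<notin> nonunits V\<^sub>0" "poly p b \<in> nonunits V\<^sub>0"
    using b(2) by (auto simp: algebraic_mod_def)
  obtain n where n: "coeff p n \<notin> nonunits V\<^sub>0" "\<And>i. i > n \<Longrightarrow> coeff p i \<in> nonunits V\<^sub>0"
    using top_coeff_outside[OF p(2)] zero_nonunits local_subring_subring[OF V0] by blast
  have V': "val_in V\<^sub>0 V" "D \<subseteq> V" "nonunits V \<inter> D \<subseteq> nonunits V\<^sub>0"
    using V by (auto simp: vals_def)
  show ?thesis
    using integral_in_val[OF V0 V'(1) b(1) _ p(3) _ n(2)] n(1) V' p(1) poly_over_mono[of p D V]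
      poly_over_coeff[of p D n] by blast
qed

text \<open>Every \<open>b\<close> in \<open>D[s]\<close> lies in all places over \<open>D\<close>
  and is thus algebraic itself. A nonzero algebraic element cannot vanish at a place that is trivial
  on \<open>D\<close>.\<close>

lemma vals_adjoin_algebraic:
  assumes V0: "local_subring V\<^sub>0" and D: "subring_set D" "D \<subseteq> V\<^sub>0"
    and s: "s \<in> V\<^sub>0" "algebraic_mod V\<^sub>0 D s" and V: "V \<in> vals V\<^sub>0 D"
  shows "V \<in> vals V\<^sub>0 (adjoin D s)"
proof -
  have V': "val_in V\<^sub>0 V" "D \<subseteq> V" "nonunits V \<inter> D \<subseteq> nonunits V\<^sub>0"
    using V by (auto simp: vals_def)
  note sub = local_subring_subring[OF V0]
  have inV: "adjoin D s \<subseteq> V'" if "V' \<in> vals V\<^sub>0 D" for V'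
    using that algebraic_mod_in_vals[OF V0 that s] val_in_subring by (intro adjoin_subset) (auto simp: vals_def)
  have subV: "subring_set V" and ideal: "ideal_of (nonunits V) V"
    using V'(1) val_in_subring nonunits_ideal_of val_in_local[OF V0] by auto
  have "b \<in> nonunits V\<^sub>0" if b: "b \<in> nonunits V" "b \<in> adjoin D s" for b
  proof (rule ccontr)
    assume nb: "b \<notin> nonunits V\<^sub>0"
    have bV0: "b \<in> V\<^sub>0"
      using inV[OF V] b V'(1) by (auto simp: val_in_def)
    have "algebraic_mod V\<^sub>0 D b"
      using inV b nb bV0 by (intro algebraic_mod_if_in_all_vals[OF V0 D]) auto
    then obtain p i where p: "p \<in> poly_over D" "poly p b \<in> nonunits V\<^sub>0" "coeff p i \<notin> nonunits V\<^sub>0"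
      by (auto simp: algebraic_mod_def)
    \<comment> \<open>The constant coefficient vanishes at \<open>V\<close> and lies in
      \<open>D\<close>, hence vanishes modulo \<open>nonunits V\<^sub>0\<close>; then a factor
      \<open>b\<close> is cancelled and the shorter polynomial has the same property.\<close>
    have "\<forall>i. coeff p i \<in> nonunits V\<^sub>0" if "p \<in> poly_over D" "poly p b \<in> nonunits V\<^sub>0" for p
      using that
    proof (induction p rule: pCons_induct)
      case 0
      then show ?case
        using zero_nonunits[OF sub] by simp
    next
      case (pCons c p)
      have c: "c \<in> D" and pD: "p \<in> poly_over D"
        using pCons.prems by (auto simp: poly_over_pCons)
      have pV: "poly p b \<in> V"
        using pD V'(2) b subV nonunits_subset[of b V] poly_over_mono[of p D V]
        by (intro poly_over_eval[OF ideal_of_self]) auto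
      have "poly (pCons c p) b - b * poly p b \<in> nonunits V"
        using pCons.prems pV b(1) val_in_nonunits[OF V'(1)] ideal subV
        by (intro ideal_of_diff[OF ideal subV] ideal_of_mult_right[OF ideal]) auto
      then have c0: "c \<in> nonunits V\<^sub>0"
        using c V'(3) by auto
      then have "poly (pCons c p) b - c \<in> nonunits V\<^sub>0"
        using pCons.prems ideal_of_diff[OF nonunits_ideal_of[OF V0] sub] by blast
      then have "b * poly p b \<in> nonunits V\<^sub>0"
        by simp
      then have "poly p b \<in> nonunits V\<^sub>0"
        using prime_of_mult[OF nonunits_prime_of[OF V0] bV0] nb pV V'(1) val_in_subset by blast
      with pCons.IH pD c0 show ?case
        by (auto simp: coeff_pCons split: nat.splits)
    qed
    with p show False by blast
  qed
  then show ?thesis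
    using inV[OF V] V' by (auto simp: vals_def)
qed

section \<open>Zariski's lemma\<close>

text \<open>
  For \<open>V\<^sub>0 = UNIV\<close> and \<open>D\<close> a field this is Zariski's lemma: if \<open>D[S]\<close> is a field then only the
  trivial valuation ring contains it, so every element is algebraic over \<open>D\<close>. In the essential
  case \<open>s\<close> is transcendental and \<open>S\<close> is algebraic over \<open>D[s]\<close>; where \<open>1 + s a\<close> vanishes, the
  product \<open>a\<close> of the leading coefficients does not, which makes \<open>S\<close> integral there.
\<close>

lemma exists_val_containing_finite:
  assumes V0: "local_subring V\<^sub>0" and S: "finite S"
  shows "S \<subseteq> V\<^sub>0 \<Longrightarrow> subring_set D \<Longrightarrow> D \<subseteq> V\<^sub>0 \<Longrightarrow> V\<^sub>1 \<in> vals V\<^sub>0 D \<Longrightarrow> V\<^sub>1 \<noteq> V\<^sub>0 \<Longrightarrow>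
    \<exists>V \<in> vals V\<^sub>0 D. S \<subseteq> V \<and> V \<noteq> V\<^sub>0"
  using S
proof (induction S arbitrary: D V\<^sub>1 rule: finite_induct)
  case empty
  then show ?case by blast
next
  case (insert s S)
  note sub = local_subring_subring[OF V0] and m = nonunits_prime_of[OF V0]
  note D = \<open>subring_set D\<close> \<open>D \<subseteq> V\<^sub>0\<close>
  have s: "s \<in> V\<^sub>0" and S: "S \<subseteq> V\<^sub>0"
    using insert.prems by auto
  let ?E = "adjoin D s"
  have E: "subring_set ?E" "?E \<subseteq> V\<^sub>0" "D \<subseteq> ?E" "s \<in> ?E"
    using subring_set_adjoin[OF D(1)] adjoin_subset[OF sub D(2) s] subset_adjoin[of D s]
      self_adjoin[OF D(1)] D(1) by auto
  show ?case
  proof (cases "\<exists>V \<in> vals V\<^sub>0 ?E. V \<noteq> V\<^sub>0")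
    case True
    then obtain V where "V \<in> vals V\<^sub>0 ?E" "V \<noteq> V\<^sub>0" by blast
    from insert.IH[OF S E(1,2) this] obtain V where V: "V \<in> vals V\<^sub>0 ?E" "S \<subseteq> V" "V \<noteq> V\<^sub>0"
      by blast
    then have "insert s S \<subseteq> V" "V \<in> vals V\<^sub>0 D"
      using E vals_antimono by (auto simp: vals_def)
    then show ?thesis
      using V by blast
  next
    case False
    \<comment> \<open>If \<open>s\<close> were algebraic, \<open>V\<^sub>1\<close> would remain
      trivial on \<open>?E\<close>.\<close>
    have trans: "\<not> algebraic_mod V\<^sub>0 D s"
      using vals_adjoin_algebraic[OF V0 D s _ insert.prems(4)] False insert.prems(5) by blast
    \<comment> \<open>The only place trivial on \<open>?E\<close> is \<open>V\<^sub>0\<close>, so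
      \<open>t\<close> is algebraic; \<open>n\<close> marks the leading coefficient of its reduced
      relation.\<close>
    have "\<exists>p n. p \<in> poly_over ?E \<and> poly p t \<in> nonunits V\<^sub>0 \<and> coeff p n \<notin> nonunits V\<^sub>0 \<and>
        (\<forall>i>n. coeff p i \<in> nonunits V\<^sub>0)" if t: "t \<in> S - nonunits V\<^sub>0" for t
    proof -
      have "algebraic_mod V\<^sub>0 ?E t"
        using t S False by (intro algebraic_mod_if_in_all_vals[OF V0 E(1,2)]) auto
      then obtain p i where p: "p \<in> poly_over ?E" "coeff p i \<notin> nonunits V\<^sub>0" "poly p t \<in> nonunits V\<^sub>0"
        by (auto simp: algebraic_mod_def)
      then show ?thesis
        using top_coeff_outside[OF p(2) zero_nonunits[OF sub]] by metis
    qed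
    then obtain P N where P: "\<And>t. t \<in> S - nonunits V\<^sub>0 \<Longrightarrow> P t \<in> poly_over ?E \<and>
        poly (P t) t \<in> nonunits V\<^sub>0 \<and> coeff (P t) (N t) \<notin> nonunits V\<^sub>0 \<and>
        (\<forall>i>N t. coeff (P t) i \<in> nonunits V\<^sub>0)"
      by metis
    \<comment> \<open>Members of \<open>S\<close> that vanish in the residue field of
      \<open>V\<^sub>0\<close> lie in every \<open>V\<close> anyway.\<close>
    define T where "T = S - nonunits V\<^sub>0"
    define a where "a = (\<Prod>t\<in>T. coeff (P t) (N t))"
    have "finite T"
      using insert by (simp add: T_def)
    have aE: "a \<in> ?E"
      unfolding a_def T_def using P E poly_over_coeff by (intro subring_set_prod) blast+
    have "a \<in> V\<^sub>0 - nonunits V\<^sub>0"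
      unfolding a_def T_def using P E poly_over_coeff by (intro prime_of_prod[OF m sub]) blast
    then have am: "a \<notin> nonunits V\<^sub>0" by blast
    obtain \<alpha> where \<alpha>: "\<alpha> \<in> poly_over D" "a = poly \<alpha> s"
      using aE by (auto simp: adjoin_def)
    define q where "q = pCons 1 \<alpha>"
    have q: "q \<in> poly_over D"
      using D \<alpha> by (simp add: q_def poly_over_pCons)
    have qs: "poly q s = 1 + s * a"
      by (simp add: q_def \<alpha>)
    \<comment> \<open>\<open>1 + s * a\<close> is not a unit of \<open>F[s]\<close>, where
      \<open>F\<close> is the fraction field of the image of \<open>D\<close>: \<open>s\<close> is
      transcendental, and \<open>q\<close> has positive degree after reduction because
      \<open>a\<close> is nonzero there.\<close>
    have "\<not> (\<exists>d \<in> D - nonunits V\<^sub>0. \<exists>p \<in> poly_over D. d - poly q s * poly p s \<in> nonunits V\<^sub>0)"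
    proof safe
      fix d p assume d: "d \<in> D" "d \<notin> nonunits V\<^sub>0" and p: "p \<in> poly_over D"
        and "d - poly q s * poly p s \<in> nonunits V\<^sub>0"
      then have "poly ([:d:] - q * p) s \<in> nonunits V\<^sub>0" by simp
      moreover have "[:d:] - q * p \<in> poly_over D"
        using d p q D ideal_of_self[OF D(1)]
        by (intro poly_over_diff poly_over_mult) (auto simp: poly_over_pCons)
      ultimately have m1: "coeff ([:d:] - q * p) i \<in> nonunits V\<^sub>0" for i
        using trans unfolding algebraic_mod_def by blast
      have z: "0 \<in> nonunits V\<^sub>0"
        using sub by (rule zero_nonunits)
      have cV: "coeff q i \<in> V\<^sub>0" "coeff p i \<in> V\<^sub>0" for i
        using p q D poly_over_coeff by blast+
      have mi: "ideal_of (nonunits V\<^sub>0) V\<^sub>0"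
        using V0 by (rule nonunits_ideal_of)
      obtain i where "coeff \<alpha> i \<notin> nonunits V\<^sub>0"
      proof (rule ccontr)
        assume "\<not> thesis"
        then have "\<alpha> \<in> poly_over (nonunits V\<^sub>0)"
          using that by (auto simp: poly_over_def)
        then show False
          using am \<alpha> poly_over_eval[OF mi _ sub s] by blast
      qed
      then have "coeff q (Suc i) \<notin> nonunits V\<^sub>0"
        by (simp add: q_def)
      then obtain i\<^sub>0 where i0: "coeff q i\<^sub>0 \<notin> nonunits V\<^sub>0" "\<And>i. i > i\<^sub>0 \<Longrightarrow> coeff q i \<in> nonunits V\<^sub>0"
        using top_coeff_outside[of q _ "nonunits V\<^sub>0"] z by blast
      have "i\<^sub>0 \<noteq> 0"
        using i0(2)[of "Suc i"] \<open>coeff q (Suc i) \<notin> nonunits V\<^sub>0\<close> by (cases i\<^sub>0) auto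
      obtain j where "coeff p j \<notin> nonunits V\<^sub>0"
      proof (rule ccontr)
        assume "\<not> thesis"
        then have "p \<in> poly_over (nonunits V\<^sub>0)"
          using that by (auto simp: poly_over_def)
        then have "q * p \<in> poly_over (nonunits V\<^sub>0)"
          using q D poly_over_mono by (intro poly_over_mult[OF mi]) blast
        then have "coeff ([:d:] - q * p) 0 + coeff (q * p) 0 \<in> nonunits V\<^sub>0"
          using m1[of 0] by (intro ideal_of_add[OF mi]) (simp_all add: poly_over_def)
        then show False
          using d by simp
      qed
      then obtain j\<^sub>0 where j0: "coeff p j\<^sub>0 \<notin> nonunits V\<^sub>0" "\<And>i. i > j\<^sub>0 \<Longrightarrow> coeff p i \<in> nonunits V\<^sub>0"
        using top_coeff_outside[of p _ "nonunits V\<^sub>0"] z by blast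
      \<comment> \<open>The two leading coefficients meet in degree
        \<open>i\<^sub>0 + j\<^sub>0 > 0\<close>, where the constant \<open>d\<close> contributes
        nothing.\<close>
      have "coeff (q * p) (i\<^sub>0 + j\<^sub>0) \<in> nonunits V\<^sub>0"
        using m1[of "i\<^sub>0 + j\<^sub>0"] \<open>i\<^sub>0 \<noteq> 0\<close> ideal_of_uminus[OF mi sub, of "- coeff (q * p) (i\<^sub>0 + j\<^sub>0)"]
        by (cases "i\<^sub>0 + j\<^sub>0") (auto simp: coeff_pCons)
      moreover have "coeff (q * p) (i\<^sub>0 + j\<^sub>0) = coeff q i\<^sub>0 * coeff p j\<^sub>0 +
          (\<Sum>i\<in>{..i\<^sub>0 + j\<^sub>0} - {i\<^sub>0}. coeff q i * coeff p (i\<^sub>0 + j\<^sub>0 - i))"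
        unfolding coeff_mult by (subst sum.remove[of _ i\<^sub>0]) auto
      moreover have "(\<Sum>i\<in>{..i\<^sub>0 + j\<^sub>0} - {i\<^sub>0}. coeff q i * coeff p (i\<^sub>0 + j\<^sub>0 - i)) \<in> nonunits V\<^sub>0"
      proof (rule ideal_of_sum[OF mi])
        fix i assume "i \<in> {..i\<^sub>0 + j\<^sub>0} - {i\<^sub>0}"
        then have "i > i\<^sub>0 \<or> i\<^sub>0 + j\<^sub>0 - i > j\<^sub>0" by auto
        then show "coeff q i * coeff p (i\<^sub>0 + j\<^sub>0 - i) \<in> nonunits V\<^sub>0"
          using i0(2) j0(2) cV ideal_of_mult[OF mi] ideal_of_mult_right[OF mi] by blast
      qed
      ultimately have "coeff q i\<^sub>0 * coeff p j\<^sub>0 \<in> nonunits V\<^sub>0"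
        using ideal_of_diff[OF mi sub] by (metis add_diff_cancel_right')
      then show False
        using prime_of_mult[OF m cV] i0 j0 by blast
    qed
    then obtain V where V: "V \<in> vals V\<^sub>0 D" "s \<in> V" "1 + s * a \<in> nonunits V"
      using exists_val_or_inverse[OF V0 D s q] qs by auto
    then have val: "val_in V\<^sub>0 V" "D \<subseteq> V"
      by (auto simp: vals_def)
    have subV: "subring_set V" and prime: "prime_of (nonunits V) V"
      using val(1) val_in_subring nonunits_prime_of val_in_local[OF V0] by auto
    note ideal = prime_of_ideal[OF prime]
    have EV: "?E \<subseteq> V"
      using val V subV by (intro adjoin_subset)
    have aV: "a \<notin> nonunits V"
      using ideal_of_diff[OF ideal subV V(3) ideal_of_mult[OF ideal V(2)], of a] one_nonunits by auto
    have "t \<in> V" if "t \<in> S" for t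
    proof (cases "t \<in> nonunits V\<^sub>0")
      case True
      then show ?thesis
        using val by (auto simp: val_in_def)
    next
      case False
      then have tT: "t \<in> T"
        using that by (simp add: T_def)
      have "a = coeff (P t) (N t) * (\<Prod>t\<in>T - {t}. coeff (P t) (N t))"
        unfolding a_def by (rule prod.remove) (use \<open>finite T\<close> tT in auto)
      moreover have "(\<Prod>t\<in>T - {t}. coeff (P t) (N t)) \<in> V"
        using P E EV poly_over_coeff T_def by (intro subring_set_prod[OF subV]) blast
      ultimately have "coeff (P t) (N t) \<notin> nonunits V"
        using aV ideal_of_mult_right[OF ideal] by metis
      then show ?thesis
        using P[of t] that False S poly_over_mono[OF _ EV, of "P t"]
        by (intro integral_in_val[OF V0 val(1), of t "P t" "N t"]) auto
    qed
    \<comment> \<open>Otherwise \<open>q\<close>, whose constant coefficient is \<open>1\<close>,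
      would be an algebraic relation for \<open>s\<close>.\<close>
    moreover have "V \<noteq> V\<^sub>0"
    proof
      assume "V = V\<^sub>0"
      then have "poly q s \<in> nonunits V\<^sub>0" "coeff q 0 \<notin> nonunits V\<^sub>0"
        using V(3) qs one_nonunits[of V\<^sub>0] by (simp, simp add: q_def)
      then have "algebraic_mod V\<^sub>0 D s"
        unfolding algebraic_mod_def using q by blast
      with trans show False ..
    qed
    ultimately show ?thesis
      using V by blast
  qed
qed

section \<open>Localization at a prime inside the field\<close>

lemma subset_localization: "subring_set A \<Longrightarrow> prime_of P A \<Longrightarrow> A \<subseteq> localization_at A P"
proof
  fix x assume A: "subring_set A" "prime_of P A" and x: "x \<in> A"
  have "x = x / 1" "1 \<in> A - P"
    using A by (auto simp: prime_of_one)
  with x show "x \<in> localization_at A P"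
    unfolding localization_at_def by blast
qed

lemma subring_set_localization:
  assumes A: "subring_set A" and P: "prime_of P (A :: 'a::field set)"
  shows "subring_set (localization_at A P)"
  unfolding subring_set_def
proof (intro conjI ballI)
  show "1 \<in> localization_at A P"
    using subset_localization[OF A P] A by auto
  fix x y assume "x \<in> localization_at A P" "y \<in> localization_at A P"
  then obtain a b c d where xy: "x = a / b" "y = c / d" "a \<in> A" "c \<in> A" "b \<in> A - P" "d \<in> A - P"
    by (auto simp: localization_at_def)
  then have "b \<noteq> 0" "d \<noteq> 0"
    using prime_of_ideal[OF P] by auto
  then have "x - y = (a * d - c * b) / (b * d)" "x * y = (a * c) / (b * d)"
    using xy by (auto simp: field_simps)
  moreover have "a * d - c * b \<in> A" "a * c \<in> A"
    using xy A by (auto intro!: subring_set_closed)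
  moreover have "b * d \<in> A - P"
    using xy A P by (auto intro: subring_set_mult dest: prime_of_mult)
  ultimately show "x - y \<in> localization_at A P" "x * y \<in> localization_at A P"
    unfolding localization_at_def by blast+
qed

lemma nonunits_localization:
  assumes A: "subring_set A" and P: "prime_of P (A :: 'a::field set)"
  shows "nonunits (localization_at A P) = {a / b | a b. a \<in> P \<and> b \<in> A - P}"
proof (intro equalityI subsetI)
  note Pi = prime_of_ideal[OF P]
  fix x assume x: "x \<in> nonunits (localization_at A P)"
  then obtain a b where ab: "x = a / b" "a \<in> A" "b \<in> A - P"
    by (auto simp: nonunits_def localization_at_def)
  have "a \<in> P"
  proof (rule ccontr)
    assume "a \<notin> P"
    then have "inverse x = b / a" "b \<in> A" "a \<in> A - P"
      using ab by auto
    moreover from this have "x \<noteq> 0"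
      using ab Pi by auto
    ultimately have "inverse x \<in> localization_at A P" "x \<noteq> 0"
      unfolding localization_at_def by blast+
    then show False
      using x by (auto simp: nonunits_def)
  qed
  with ab show "x \<in> {a / b | a b. a \<in> P \<and> b \<in> A - P}"
    by blast
next
  note Pi = prime_of_ideal[OF P]
  fix x assume "x \<in> {a / b | a b. a \<in> P \<and> b \<in> A - P}"
  then obtain a b where ab: "x = a / b" "a \<in> P" "b \<in> A - P" by blast
  have "inverse x \<notin> localization_at A P" if "x \<noteq> 0"
  proof
    assume "inverse x \<in> localization_at A P"
    then obtain c d where cd: "inverse x = c / d" "c \<in> A" "d \<in> A - P"
      by (auto simp: localization_at_def)
    then have "b * d = a * c"
      using ab that Pi by (auto simp: field_simps)
    then show False
      using prime_of_mult[OF P, of b d] ideal_of_mult_right[OF Pi, of c a] ab cd by auto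
  qed
  moreover have "x \<in> localization_at A P"
    using ab Pi ideal_of_subset unfolding localization_at_def by blast
  ultimately show "x \<in> nonunits (localization_at A P)"
    by (auto simp: nonunits_def)
qed

lemma local_subring_localization:
  assumes A: "subring_set A" and P: "prime_of P (A :: 'a::field set)"
  shows "local_subring (localization_at A P)"
  unfolding local_subring_def nonunits_localization[OF A P]
proof (intro conjI ballI)
  show "subring_set (localization_at A P)"
    using A P by (rule subring_set_localization)
  fix x y assume "x \<in> {a / b | a b. a \<in> P \<and> b \<in> A - P}" "y \<in> {a / b | a b. a \<in> P \<and> b \<in> A - P}"
  then obtain a b c d where xy: "x = a / b" "y = c / d" "a \<in> P" "c \<in> P" "b \<in> A - P" "d \<in> A - P"
    by blast
  then have "b \<noteq> 0" "d \<noteq> 0"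
    using prime_of_ideal[OF P] by auto
  then have "x + y = (a * d + c * b) / (b * d)"
    using xy by (auto simp: field_simps)
  moreover have "a * d + c * b \<in> P"
    using xy prime_of_ideal[OF P] by (intro ideal_of_add ideal_of_mult_right) auto
  moreover have "b * d \<in> A - P"
    using xy A P by (auto intro: subring_set_mult dest: prime_of_mult)
  ultimately show "x + y \<in> {a / b | a b. a \<in> P \<and> b \<in> A - P}"
    by blast
qed

lemma localization_subset:
  assumes "subring_set V" "A \<subseteq> V" "nonunits V \<inter> A \<subseteq> P"
  shows "localization_at A P \<subseteq> V"
  using assms by (auto simp: localization_at_def divide_inverse intro!: subring_set_mult unit_inverse)

lemma nonunits_localization_Int:
  assumes A: "subring_set A" and P: "prime_of P (A :: 'a::field set)"
  shows "nonunits (localization_at A P) \<inter> A = P"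
proof (intro equalityI subsetI)
  fix x assume "x \<in> nonunits (localization_at A P) \<inter> A"
  then obtain a b where ab: "x = a / b" "a \<in> P" "b \<in> A - P" "x \<in> A"
    unfolding nonunits_localization[OF A P] by blast
  then have "x * b \<in> P"
    using prime_of_ideal[OF P] by auto
  then show "x \<in> P"
    using prime_of_mult[OF P, of x b] ab by auto
next
  fix x assume "x \<in> P"
  moreover have "x = x / 1" "1 \<in> A - P"
    using A P by (auto simp: prime_of_one)
  ultimately show "x \<in> nonunits (localization_at A P) \<inter> A"
    unfolding nonunits_localization[OF A P]
    using ideal_of_subset[OF prime_of_ideal[OF P]] by blast
qed

text \<open>Chevalley's theorem for the maximal ideal of the localization, whose trace on
  \<open>A\<close> is \<open>P\<close>.\<close>

lemma exists_val_over_prime: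
  assumes A: "subring_set A" and P: "prime_of P (A :: 'a::field set)"
  obtains V where "val_in UNIV V" "A \<subseteq> V" "nonunits V \<inter> A = P"
proof -
  let ?L = "localization_at A P"
  have L: "local_subring ?L"
    using A P by (rule local_subring_localization)
  have "nonunits UNIV \<subseteq> nonunits ?L"
    using zero_nonunits[OF local_subring_subring[OF L]] by simp
  then obtain V where V: "val_in UNIV V" "?L \<subseteq> V" "nonunits ?L \<subseteq> nonunits V"
    using chevalley[OF local_subring_UNIV local_subring_subring[OF L] _ nonunits_ideal_of[OF L]]
      one_nonunits[of ?L] by blast
  have "nonunits V \<inter> A \<subseteq> nonunits ?L"
    using V(2) subset_localization[OF A P] by (auto simp: nonunits_def)
  then have "nonunits V \<inter> A = P"
    using V(3) nonunits_localization_Int[OF A P] by blast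
  then show ?thesis
    using that V subset_localization[OF A P] by blast
qed

section \<open>Residue fields of places\<close>

text \<open>Algebraic closedness is a property of the type \<open>'k\<close>, so the field of
  constants is kept as the image of an embedding.\<close>

locale alg_closed_subfield =
  fixes \<phi> :: "'k::alg_closed_field \<Rightarrow> 'a::field"
  assumes hom_one: "\<phi> 1 = 1"
    and hom_add: "\<phi> (x + y) = \<phi> x + \<phi> y"
    and hom_mult: "\<phi> (x * y) = \<phi> x * \<phi> y"
begin

lemma hom_zero [simp]: "\<phi> 0 = 0"
proof -
  have "\<phi> 0 + \<phi> 0 = \<phi> 0 + 0"
    using hom_add[of 0 0] by (metis add.right_neutral)
  then show ?thesis
    by (rule add_left_imp_eq)
qed

lemma hom_uminus: "\<phi> (- x) = - \<phi> x"
  using hom_add[of x "- x"] by (simp add: eq_neg_iff_add_eq_0 add.commute)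

lemma hom_diff: "\<phi> (x - y) = \<phi> x - \<phi> y"
  using hom_add[of x "- y"] by (simp add: hom_uminus)

lemma hom_nonzero: "x \<noteq> 0 \<Longrightarrow> \<phi> x \<noteq> 0"
  using hom_mult[of x "inverse x"] by (auto simp: hom_one)

lemma hom_eq_iff: "\<phi> x = \<phi> y \<longleftrightarrow> x = y"
  using hom_nonzero[of "x - y"] by (auto simp: hom_diff)

lemma hom_inverse: "\<phi> (inverse x) = inverse (\<phi> x)"
  using hom_mult[of x "inverse x"] by (cases "x = 0") (auto simp: hom_one intro: inverse_unique[symmetric])

lemma subring_set_range: "subring_set (range \<phi>)"
  unfolding subring_set_def
proof (intro conjI ballI)
  show "1 \<in> range \<phi>"
    using hom_one by (metis rangeI)
  fix x y assume "x \<in> range \<phi>" "y \<in> range \<phi>"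
  then show "x - y \<in> range \<phi>" "x * y \<in> range \<phi>"
    by (auto simp flip: hom_diff hom_mult)
qed

lemma range_nonunits: "range \<phi> \<subseteq> V \<Longrightarrow> \<phi> c \<in> nonunits V \<Longrightarrow> c = 0"
  using hom_nonzero[of c] by (auto simp: nonunits_def simp flip: hom_inverse)

lemma poly_over_range:
  assumes "p \<in> poly_over (range \<phi>)"
  obtains q where "p = map_poly \<phi> q"
proof
  have inj: "inv_into UNIV \<phi> (\<phi> x) = x" for x
    by (rule inv_f_f) (auto simp: inj_def hom_eq_iff)
  have "inv_into UNIV \<phi> 0 = 0"
    using inj[of 0] by simp
  then show "p = map_poly \<phi> (map_poly (inv_into UNIV \<phi>) p)"
    using assms by (intro poly_eqI) (auto simp: coeff_map_poly poly_over_def f_inv_into_f)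
qed

lemma map_poly_over_range: "map_poly \<phi> q \<in> poly_over (range \<phi>)"
  by (simp add: poly_over_def coeff_map_poly)

lemma poly_map_linear_factor:
  "poly (map_poly \<phi> ([:-c, 1:] * q)) b = (b - \<phi> c) * poly (map_poly \<phi> q) b"
proof -
  have "map_poly \<phi> ([:-c, 1:] * q) = [:- \<phi> c, 1:] * map_poly \<phi> q"
    by (intro poly_eqI)
       (auto simp: coeff_map_poly hom_add hom_mult hom_uminus hom_diff coeff_pCons split: nat.splits)
  show ?thesis
    unfolding \<open>map_poly \<phi> ([:-c, 1:] * q) = [:- \<phi> c, 1:] * map_poly \<phi> q\<close> poly_mult by simp
qed

text \<open>Over \<open>k\<close> the polynomial splits into linear factors. The maximal ideal is
  prime, so it contains the value of one of them.\<close>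

lemma exists_shift_in_nonunits:
  assumes V: "local_subring V" "range \<phi> \<subseteq> V" and b: "b \<in> V"
  shows "p \<noteq> 0 \<Longrightarrow> poly (map_poly \<phi> p) b \<in> nonunits V \<Longrightarrow> \<exists>c. b - \<phi> c \<in> nonunits V"
proof (induction "degree p" arbitrary: p)
  case 0
  then obtain c where "p = [:c:]"
    by (metis degree_eq_zeroE)
  with 0 range_nonunits[OF V(2), of c] show ?case
    by (auto simp: map_poly_pCons)
next
  case (Suc n)
  then obtain c where "poly p c = 0"
    using alg_closed_imp_poly_has_root[of p] by auto
  then obtain q where q: "p = [:-c, 1:] * q"
    by (auto simp: poly_eq_0_iff_dvd)
  with Suc have "q \<noteq> 0" by auto
  then have "degree q = n"
    using Suc(2) degree_mult_eq[of "[:-c, 1:]" q] by (simp add: q del: mult_pCons_left)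
  note sub = local_subring_subring[OF V(1)]
  have "poly (map_poly \<phi> q) b \<in> V"
    using b V sub map_poly_over_range poly_over_mono
    by (intro poly_over_eval[OF ideal_of_self]) blast+
  moreover have "b - \<phi> c \<in> V"
    using b V sub by (auto intro: subring_set_diff)
  moreover have "(b - \<phi> c) * poly (map_poly \<phi> q) b \<in> nonunits V"
    using Suc.prems(2) unfolding q poly_map_linear_factor .
  ultimately have "b - \<phi> c \<in> nonunits V \<or> poly (map_poly \<phi> q) b \<in> nonunits V"
    using prime_of_mult[OF nonunits_prime_of[OF V(1)]] by blast
  then show ?case
    using Suc.hyps(1)[of q] \<open>degree q = n\<close> \<open>q \<noteq> 0\<close> by blast
qed

end

section \<open>The coordinate ring of the curve and its places\<close>

lemma adjoin_mono: "D \<subseteq> E \<Longrightarrow> adjoin D x \<subseteq> adjoin E x"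
  using poly_over_mono unfolding adjoin_def by blast

lemma poly_altdef_le:
  fixes p :: "'a::field poly"
  shows "degree p \<le> n \<Longrightarrow> poly p x = (\<Sum>i\<le>n. coeff p i * x ^ i)"
  unfolding poly_altdef by (rule sum.mono_neutral_left) (auto simp: coeff_eq_0)

text \<open>The coordinate ring sits inside its fraction field. Generation by \<open>S\<close> is
  put in the form in which it is applied to valuation rings, and dimension one enters as the absence
  of proper inclusions among nonzero primes.\<close>

locale affine_curve = alg_closed_subfield \<phi> for \<phi> :: "'k::alg_closed_field \<Rightarrow> 'a::field" +
  fixes R S :: "'a set"
  assumes subring_R: "subring_set R" and range_R: "range \<phi> \<subseteq> R" and S_R: "S \<subseteq> R"
    and finite_S: "finite S"
    and generated: "\<And>B. subring_set B \<Longrightarrow> range \<phi> \<subseteq> B \<Longrightarrow> S \<subseteq> B \<Longrightarrow> R \<subseteq> B"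
    and fractions: "\<And>z. \<exists>a\<in>R. \<exists>b\<in>R - {0}. z = a / b"
    and nonzero_prime_maximal:
      "\<And>P Q. prime_of P R \<Longrightarrow> prime_of Q R \<Longrightarrow> P \<subseteq> Q \<Longrightarrow> P \<noteq> {0} \<Longrightarrow> P = Q"
begin

text \<open>Weak Nullstellensatz. A nontrivial place of the residue field at \<open>Q\<close> could
  be chosen finite on the generators, hence on \<open>R\<close>. Its centre would be a prime above
  \<open>Q\<close>, so \<open>Q\<close> itself, and the place would contain the whole localization.
  Thus every residue class is algebraic over the constants.\<close>

lemma residue_field_prime:
  assumes Q: "prime_of Q R" "Q \<noteq> {0}" and x: "x \<in> R"
  shows "\<exists>c. x - \<phi> c \<in> Q"
proof (cases "x \<in> Q")
  case True
  then show ?thesis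
    by (intro exI[of _ 0]) simp
next
  case False
  define V\<^sub>0 where "V\<^sub>0 = localization_at R Q"
  have V0: "local_subring V\<^sub>0" and RV: "R \<subseteq> V\<^sub>0" and mQ: "nonunits V\<^sub>0 \<inter> R = Q"
    unfolding V\<^sub>0_def using subring_R Q
    by (auto simp: local_subring_localization nonunits_localization_Int subset_localization[THEN subsetD])
  have "V = V\<^sub>0" if V: "V \<in> vals V\<^sub>0 (range \<phi>)" for V
  proof (rule ccontr)
    assume "V \<noteq> V\<^sub>0"
    then obtain W where W: "W \<in> vals V\<^sub>0 (range \<phi>)" "S \<subseteq> W" "W \<noteq> V\<^sub>0"
      using exists_val_containing_finite[OF V0 finite_S _ subring_set_range _ V] S_R RV range_R by blast
    then have val: "val_in V\<^sub>0 W" "range \<phi> \<subseteq> W"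
      by (auto simp: vals_def)
    then have RW: "R \<subseteq> W"
      using W generated val_in_subring by blast
    have "prime_of (nonunits W \<inter> R) R"
      using nonunits_prime_of[OF val_in_local[OF V0 val(1)]] val_in_subring[OF val(1)] subring_R RW
      by (rule prime_of_restrict)
    moreover have "Q \<subseteq> nonunits W \<inter> R"
      using mQ val_in_nonunits[OF val(1)] by blast
    ultimately have "Q = nonunits W \<inter> R"
      using nonzero_prime_maximal Q by blast
    then have "V\<^sub>0 \<subseteq> W"
      unfolding V\<^sub>0_def using val_in_subring[OF val(1)] RW by (intro localization_subset) auto
    then show False
      using W val_in_subset[OF val(1)] by blast
  qed
  moreover have "x \<in> V\<^sub>0 - nonunits V\<^sub>0"
    using x False RV mQ by blast
  ultimately have "algebraic_mod V\<^sub>0 (range \<phi>) x"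
    using RV range_R by (intro algebraic_mod_if_in_all_vals[OF V0 subring_set_range]) auto
  then obtain p i where p: "p \<in> poly_over (range \<phi>)" "coeff p i \<notin> nonunits V\<^sub>0" "poly p x \<in> nonunits V\<^sub>0"
    by (auto simp: algebraic_mod_def)
  obtain q where q: "p = map_poly \<phi> q"
    using poly_over_range[OF p(1)] .
  have "q \<noteq> 0"
    using p(2) zero_nonunits[OF local_subring_subring[OF V0]] by (auto simp: q)
  then obtain c where "x - \<phi> c \<in> nonunits V\<^sub>0"
    using exists_shift_in_nonunits[OF V0, of x q] p(3) RV range_R x unfolding q by blast
  moreover have "x - \<phi> c \<in> R"
    using x range_R subring_R by (auto intro: subring_set_diff)
  ultimately show ?thesis
    using mQ by blast
qed

lemma val_eq_UNIV_if_inverses: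
  assumes "val_in UNIV V" "\<And>b. b \<in> R - {0} \<Longrightarrow> inverse b \<in> V" "R \<subseteq> V"
  shows "V = UNIV"
proof (intro equalityI subsetI)
  fix z :: 'a
  obtain a b where "a \<in> R" "b \<in> R - {0}" "z = a / b"
    using fractions by blast
  then show "z \<in> V"
    using assms val_in_subring[OF assms(1)] by (auto simp: divide_inverse intro!: subring_set_mult)
qed simp

text \<open>In other words, the function field is algebraic over \<open>k(x)\<close>. A nontrivial
  place over \<open>k(x)\<close> could be chosen finite on \<open>R\<close>; its centre is a nonzero
  prime, so \<open>x\<close> would be congruent to a constant \<open>c\<close>, and
  \<open>x - \<phi> c\<close> would be a nonzero element of \<open>k[x]\<close> vanishing
  there.\<close>

lemma vals_adjoin_trivial:
  assumes x: "x \<in> R - range \<phi>" and V: "V \<in> vals UNIV (adjoin (range \<phi>) x)"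
  shows "V = UNIV"
proof (rule ccontr)
  assume "V \<noteq> UNIV"
  let ?D = "adjoin (range \<phi>) x"
  have D: "subring_set ?D" "range \<phi> \<subseteq> ?D" "x \<in> ?D"
    using subring_set_adjoin[OF subring_set_range] subset_adjoin[of "range \<phi>" x]
      self_adjoin[OF subring_set_range] subring_set_range by auto
  obtain W where W: "W \<in> vals UNIV ?D" "S \<subseteq> W" "W \<noteq> UNIV"
    using exists_val_containing_finite[OF local_subring_UNIV finite_S _ D(1) _ V \<open>V \<noteq> UNIV\<close>] by auto
  then have val: "val_in UNIV W" "?D \<subseteq> W" "nonunits W \<inter> ?D \<subseteq> {0}"
    by (auto simp: vals_def)
  have RW: "R \<subseteq> W"
    using generated[OF val_in_subring[OF val(1)]] W D val by blast
  have Q: "prime_of (nonunits W \<inter> R) R"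
    using nonunits_prime_of[OF val_in_local[OF local_subring_UNIV val(1)]] val_in_subring[OF val(1)]
      subring_R RW by (rule prime_of_restrict)
  have "nonunits W \<inter> R \<noteq> {0}"
    using val_eq_UNIV_if_inverses[OF val(1) _ RW] W(3) RW unit_inverse by blast
  then obtain c where c: "x - \<phi> c \<in> nonunits W"
    using residue_field_prime[OF Q, of x] x by auto
  moreover have "x - \<phi> c \<in> ?D"
    using D by (auto intro: subring_set_diff)
  ultimately have "x = \<phi> c"
    using val(3) by auto
  then show False
    using x by auto
qed

text \<open>The exchange property of algebraic dependence: a polynomial relation between
  \<open>x\<close> and \<open>y\<close> is read in the other variable.\<close>

lemma algebraic_mod_swap:
  assumes alg: "algebraic_mod UNIV (adjoin (range \<phi>) x) y"
    and y: "\<And>p. p \<noteq> 0 \<Longrightarrow> poly (map_poly \<phi> p) y \<noteq> 0"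
  shows "algebraic_mod UNIV (adjoin (range \<phi>) y) x"
proof -
  obtain p i\<^sub>0 where p: "p \<in> poly_over (adjoin (range \<phi>) x)" "coeff p i\<^sub>0 \<noteq> 0" "poly p y = 0"
    using alg by (auto simp: algebraic_mod_def)
  have "\<exists>r. coeff p i = poly (map_poly \<phi> r) x" for i
  proof -
    obtain s where "s \<in> poly_over (range \<phi>)" "coeff p i = poly s x"
      using poly_over_coeff[OF p(1), of i] by (auto simp: adjoin_def)
    then show ?thesis
      using poly_over_range[of s] by metis
  qed
  then obtain r where r: "\<And>i. coeff p i = poly (map_poly \<phi> (r i)) x"
    by metis
  define n where "n = degree p"
  define m where "m = (\<Sum>i\<le>n. degree (r i))"
  \<comment> \<open>\<open>P j\<close> collects the coefficients of \<open>x ^ j\<close> in the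
    relation, as a polynomial in \<open>y\<close>; \<open>m\<close> is a crude common bound for the
    exponents.\<close>
  define P where "P j = (\<Sum>i\<le>n. monom (coeff (r i) j) i)" for j
  define q where "q = (\<Sum>j\<le>m. monom (poly (map_poly \<phi> (P j)) y) j)"
  have coeff_P: "coeff (P j) i = (if i \<le> n then coeff (r i) j else 0)" for i j
    by (simp add: P_def coeff_sum sum.delta)
  have coeff_q: "coeff q j = (if j \<le> m then poly (map_poly \<phi> (P j)) y else 0)" for j
    by (simp add: q_def coeff_sum sum.delta)
  have deg_r: "degree (map_poly \<phi> (r i)) \<le> m" if "i \<le> n" for i
  proof (rule degree_le, intro allI impI)
    fix j assume "m < j"
    moreover have "degree (r i) \<le> m"
      unfolding m_def using that by (intro member_le_sum) auto
    ultimately show "coeff (map_poly \<phi> (r i)) j = 0"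
      by (simp add: coeff_map_poly coeff_eq_0)
  qed
  have deg_P: "degree (map_poly \<phi> (P j)) \<le> n" for j
    by (intro degree_le) (simp add: coeff_map_poly coeff_P)
  have "poly q x = (\<Sum>j\<le>m. (\<Sum>i\<le>n. \<phi> (coeff (r i) j) * y ^ i) * x ^ j)"
    by (simp add: q_def poly_sum poly_monom poly_altdef_le[OF deg_P] coeff_map_poly coeff_P)
  also have "\<dots> = (\<Sum>i\<le>n. \<Sum>j\<le>m. \<phi> (coeff (r i) j) * x ^ j * y ^ i)"
    by (subst sum.swap) (simp add: sum_distrib_right sum_distrib_left mult_ac)
  also have "\<dots> = (\<Sum>i\<le>n. coeff p i * y ^ i)"
  proof (rule sum.cong)
    fix i assume "i \<in> {..n}"
    then have "coeff p i = (\<Sum>j\<le>m. \<phi> (coeff (r i) j) * x ^ j)"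
      unfolding r by (subst poly_altdef_le[OF deg_r]) (auto simp: coeff_map_poly)
    then show "(\<Sum>j\<le>m. \<phi> (coeff (r i) j) * x ^ j * y ^ i) = coeff p i * y ^ i"
      by (simp add: sum_distrib_right)
  qed simp
  also have "\<dots> = 0"
    using p(3) by (simp add: n_def poly_altdef)
  finally have "poly q x = 0" .
  moreover have "q \<in> poly_over (adjoin (range \<phi>) y)"
    using adjoinI[OF map_poly_over_range] subring_set_adjoin[OF subring_set_range]
    by (auto simp: poly_over_def coeff_q)
  moreover have "\<exists>j. coeff q j \<noteq> 0"
  proof -
    have i0: "i\<^sub>0 \<le> n"
      using p(2) by (simp add: n_def le_degree)
    \<comment> \<open>The leading coefficient of \<open>r i\<^sub>0\<close> makes \<open>P j\<close>
      nonzero, and as \<open>y\<close> is transcendental its value at \<open>y\<close> is nonzero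
      too.\<close>
    define j where "j = degree (r i\<^sub>0)"
    have "r i\<^sub>0 \<noteq> 0"
      using p(2) r[of i\<^sub>0] by auto
    then have "coeff (P j) i\<^sub>0 \<noteq> 0"
      using i0 by (simp add: coeff_P j_def)
    then have "P j \<noteq> 0" by auto
    moreover have "j \<le> m"
      using i0 member_le_sum[of i\<^sub>0 "{..n}" "\<lambda>i. degree (r i)"] by (auto simp: m_def j_def)
    ultimately show ?thesis
      using y[of "P j"] by (intro exI[of _ j]) (simp add: coeff_q)
  qed
  ultimately show ?thesis
    by (auto simp: algebraic_mod_def)
qed

text \<open>If the residue of \<open>y\<close> were transcendental over the constants,
  \<open>V\<close> would be trivial on \<open>k[y]\<close>. By exchange a nonconstant
  \<open>x\<close> in \<open>R\<close> is algebraic over \<open>k(y)\<close>, so \<open>V\<close>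
  would be trivial on \<open>k[x]\<close> as well, which leaves only the whole field.\<close>

lemma residue_field_val:
  assumes V: "val_in UNIV V" "V \<noteq> UNIV" "range \<phi> \<subseteq> V" and y: "y \<in> V"
  shows "\<exists>c. y - \<phi> c \<in> nonunits V"
proof (rule ccontr)
  assume neg: "\<not> ?thesis"
  have loc: "local_subring V"
    using val_in_local[OF local_subring_UNIV V(1)] .
  note subV = local_subring_subring[OF loc]
  have y_trans: "poly (map_poly \<phi> p) y \<notin> nonunits V" if "p \<noteq> 0" for p
    using exists_shift_in_nonunits[OF loc V(3) y that] neg by blast
  have "\<not> R \<subseteq> range \<phi>"
  proof
    assume R: "R \<subseteq> range \<phi>"
    have "inverse b \<in> V" if "b \<in> R - {0}" for b
    proof -
      have "b \<in> range \<phi>"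
        using that R by blast
      then obtain c where "b = \<phi> c" ..
      then show ?thesis
        using V(3) hom_inverse[of c] by (metis range_subsetD)
    qed
    then show False
      using val_eq_UNIV_if_inverses[OF V(1)] V R by blast
  qed
  then obtain x where x: "x \<in> R - range \<phi>" by blast
  have "y \<noteq> 0"
    using neg zero_nonunits[OF subV] by (auto dest: spec[of _ 0])
  moreover have "subring_set (adjoin (range \<phi>) x)"
    using subring_set_range by (rule subring_set_adjoin)
  ultimately have "algebraic_mod UNIV (adjoin (range \<phi>) x) y"
    using vals_adjoin_trivial[OF x] by (intro algebraic_mod_if_in_all_vals) auto
  then have alg: "algebraic_mod UNIV (adjoin (range \<phi>) y) x"
  proof (rule algebraic_mod_swap)
    fix p :: "'k poly" assume "p \<noteq> 0"
    from y_trans[OF this] show "poly (map_poly \<phi> p) y \<noteq> 0"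
      using zero_nonunits[OF subV] by auto
  qed
  have "adjoin (range \<phi>) y \<subseteq> V"
    using subV V(3) y by (rule adjoin_subset)
  moreover have "nonunits V \<inter> adjoin (range \<phi>) y \<subseteq> {0}"
  proof
    fix z assume z: "z \<in> nonunits V \<inter> adjoin (range \<phi>) y"
    then obtain p where "p \<in> poly_over (range \<phi>)" "z = poly p y"
      by (auto simp: adjoin_def)
    then obtain q where "z = poly (map_poly \<phi> q) y"
      using poly_over_range by metis
    then show "z \<in> {0}"
      using y_trans[of q] z by (cases "q = 0") auto
  qed
  ultimately have "V \<in> vals UNIV (adjoin (range \<phi>) y)"
    using V by (simp add: vals_def)
  then have "V \<in> vals UNIV (adjoin (adjoin (range \<phi>) y) x)"
    by (rule vals_adjoin_algebraic[OF local_subring_UNIV subring_set_adjoin[OF subring_set_range]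
          subset_UNIV UNIV_I alg])
  moreover have "adjoin (range \<phi>) x \<subseteq> adjoin (adjoin (range \<phi>) y) x"
    using subring_set_range by (intro adjoin_mono subset_adjoin) auto
  ultimately have "V \<in> vals UNIV (adjoin (range \<phi>) x)"
    by (rule vals_antimono)
  then show False
    using vals_adjoin_trivial[OF x] V by blast
qed

end

section \<open>Discrete valuation rings\<close>

text \<open>The value \<open>v 0\<close> is arbitrary, so zero is split off everywhere. The value
  group may be any nonzero subgroup of the integers.\<close>

definition dvr :: "'a::field set \<Rightarrow> ('a \<Rightarrow> int) \<Rightarrow> bool" where
  "dvr V v \<longleftrightarrow> subring_set V \<and> (\<forall>x y. x \<noteq> 0 \<longrightarrow> y \<noteq> 0 \<longrightarrow> v (x * y) = v x + v y) \<and>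
     (\<forall>x. x \<in> V \<longleftrightarrow> x = 0 \<or> v x \<ge> 0) \<and> V \<noteq> UNIV"

lemma dvr_subring: "dvr V v \<Longrightarrow> subring_set V"
  and dvr_mult: "dvr V v \<Longrightarrow> x \<noteq> 0 \<Longrightarrow> y \<noteq> 0 \<Longrightarrow> v (x * y) = v x + v y"
  and dvr_mem_iff: "dvr V v \<Longrightarrow> x \<in> V \<longleftrightarrow> x = 0 \<or> v x \<ge> 0"
  and dvr_proper: "dvr V v \<Longrightarrow> V \<noteq> UNIV"
  by (auto simp: dvr_def)

lemma dvr_one: "dvr V v \<Longrightarrow> v 1 = 0"
  using dvr_mult[of V v 1 1] by simp

lemma dvr_power: "dvr V v \<Longrightarrow> x \<noteq> 0 \<Longrightarrow> v (x ^ n) = int n * v x"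
  by (induction n) (auto simp: dvr_one dvr_mult algebra_simps)

lemma dvr_inverse: "dvr V v \<Longrightarrow> x \<noteq> 0 \<Longrightarrow> v (inverse x) = - v x"
  using dvr_mult[of V v x "inverse x"] by (simp add: dvr_one)

lemma dvr_divide: "dvr V v \<Longrightarrow> x \<noteq> 0 \<Longrightarrow> y \<noteq> 0 \<Longrightarrow> v (x / y) = v x - v y"
  by (simp add: divide_inverse dvr_mult dvr_inverse)

lemma dvr_uminus:
  assumes V: "dvr V v"
  shows "v (- x) = v x"
proof (cases "x = 0")
  case False
  have "v (-1) + v (-1) = 0"
    using dvr_mult[OF V, of "-1" "-1"] dvr_one[OF V] by simp
  then show ?thesis
    using dvr_mult[OF V, of "-1" x] False by simp
qed simp

lemma dvr_nonunits_iff: "dvr V v \<Longrightarrow> x \<in> nonunits V \<longleftrightarrow> x = 0 \<or> v x > 0"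
  by (auto simp: nonunits_def dvr_mem_iff dvr_inverse)

text \<open>The ultrametric inequality is derived from closure of \<open>V\<close> under adding
  \<open>1\<close> to a quotient.\<close>

lemma dvr_add_ge:
  assumes V: "dvr V v" and nz: "x \<noteq> 0" "y \<noteq> 0" "x + y \<noteq> 0"
  shows "v x \<le> v (x + y) \<or> v y \<le> v (x + y)"
proof -
  have *: "v y \<le> v (x + y)" if "v y \<le> v x" "x \<noteq> 0" "y \<noteq> 0" "x + y \<noteq> 0" for x y
  proof -
    have "x / y \<in> V"
      using that V by (simp add: dvr_mem_iff dvr_divide)
    then have "x / y + 1 \<in> V"
      using dvr_subring[OF V] by (auto intro: subring_set_add)
    moreover have "x / y + 1 = (x + y) / y"
      using that by (simp add: field_simps)
    ultimately show ?thesis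
      using that V by (simp add: dvr_mem_iff dvr_divide)
  qed
  show ?thesis
    using *[of x y] *[of y x] nz by (cases "v x \<le> v y") (auto simp: add.commute)
qed

lemma dvr_add_eq:
  assumes V: "dvr V v" and x: "x \<noteq> 0" and y: "y = 0 \<or> v x < v y"
  shows "x + y \<noteq> 0" "v (x + y) = v x"
proof -
  have *: "x + y \<noteq> 0 \<and> v (x + y) = v x" if y: "y \<noteq> 0" "v x < v y"
  proof
    show nz: "x + y \<noteq> 0"
      using that dvr_uminus[OF V, of y] by (metis add_eq_0_iff2 less_irrefl)
    then show "v (x + y) = v x"
      using dvr_add_ge[OF V x y(1) nz] dvr_add_ge[OF V nz, of "- y"] x that
      by (auto simp: dvr_uminus[OF V])
  qed
  show "x + y \<noteq> 0" "v (x + y) = v x"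
    using * x y by (cases "y = 0"; simp)+
qed

lemma dvr_val_in: "dvr V v \<Longrightarrow> val_in UNIV V"
  by (auto simp: val_in_UNIV dvr_subring) (auto simp: dvr_mem_iff dvr_inverse)

text \<open>An element \<open>z\<close> of \<open>B\<close> outside \<open>V\<close> has a pole, and
  a high power of it absorbs the pole of any \<open>w\<close>, so that \<open>w / z ^ n\<close> lies
  in \<open>V\<close>.\<close>

lemma dvr_maximal:
  assumes V: "dvr V v" and B: "subring_set B" "V \<subseteq> B" "B \<noteq> UNIV"
  shows "B = V"
proof (rule ccontr)
  assume "B \<noteq> V"
  then obtain z where z: "z \<in> B" "z \<noteq> 0" "v z < 0"
    using B dvr_mem_iff[OF V] by force
  have "w \<in> B" if "w \<noteq> 0" for w
  proof -
    define n where "n = nat \<bar>v w\<bar>"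
    have "\<bar>v w\<bar> * 1 \<le> \<bar>v w\<bar> * (- v z)"
      using z by (intro mult_left_mono) auto
    then have "0 \<le> v (w / z ^ n)"
      using z that by (simp add: dvr_divide[OF V] dvr_power[OF V] n_def)
    then have "w / z ^ n \<in> B"
      using B dvr_mem_iff[OF V] by blast
    then have "w / z ^ n * z ^ n \<in> B"
      using B z by (intro subring_set_mult subring_set_power)
    then show ?thesis
      using z by simp
  qed
  then have "w \<in> B" for w
    using subring_set_zero[OF B(1)] by (cases "w = 0") auto
  then show False
    using B(3) by blast
qed

section \<open>Functions with prescribed behaviour at a place of the curve\<close>

context affine_curve
begin

lemma dvr_hom:
  assumes "dvr V v" "range \<phi> \<subseteq> V" "c \<noteq> 0"
  shows "v (\<phi> c) = 0"
proof -
  have "\<phi> c \<in> V" "\<phi> (inverse c) \<in> V"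
    using assms by auto
  then show ?thesis
    using assms hom_nonzero[of c] by (auto simp: hom_inverse dvr_mem_iff dvr_inverse)
qed

text \<open>The residue field is \<open>k\<close>, so \<open>c\<close> can be taken as the residue
  of the unit \<open>a / b\<close>: the graded pieces of the valuation are one-dimensional over
  \<open>k\<close>.\<close>

lemma dvr_leading_constant:
  assumes V: "dvr V v" "range \<phi> \<subseteq> V" and ab: "a \<noteq> 0" "b \<noteq> 0" "v a = v b"
  obtains c where "c \<noteq> 0" "a - \<phi> c * b = 0 \<or> v a < v (a - \<phi> c * b)"
proof -
  have "a / b \<in> V"
    using ab by (simp add: dvr_mem_iff[OF V(1)] dvr_divide[OF V(1)])
  then obtain c where c: "a / b - \<phi> c \<in> nonunits V"
    using residue_field_val[OF dvr_val_in[OF V(1)] dvr_proper[OF V(1)] V(2)] by blast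
  have eq: "a - \<phi> c * b = b * (a / b - \<phi> c)"
    using ab by (simp add: field_simps)
  have "a - \<phi> c * b = 0 \<or> v a < v (a - \<phi> c * b)"
    using c ab dvr_mult[OF V(1) ab(2), of "a / b - \<phi> c"] unfolding eq dvr_nonunits_iff[OF V(1)]
    by (cases "a / b - \<phi> c = 0") simp_all
  moreover have "c \<noteq> 0"
    using calculation ab by auto
  ultimately show ?thesis
    using that by blast
qed

text \<open>
  If \<open>R\<close> has no function vanishing at \<open>V\<close>, then \<open>- v\<close> is a degree function on \<open>R\<close> with
  one-dimensional graded pieces, so \<open>R\<close> is a finite module over \<open>k[f]\<close>, generated by elements
  \<open>g r\<close> of minimal degree in the residue classes modulo \<open>n = deg f\<close>. This bounds the poles at any
  other place \<open>U\<close> and forces its valuation to be proportional to \<open>v\<close>.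
\<close>

lemma exists_zero_at_place:
  assumes V: "dvr V v" "range \<phi> \<subseteq> V" "\<not> R \<subseteq> V"
    and U: "dvr U u" "range \<phi> \<subseteq> U" "\<not> R \<subseteq> U" and UV: "U \<noteq> V"
  shows "\<exists>h\<in>R. h \<noteq> 0 \<and> v h > 0"
proof (rule ccontr)
  assume neg: "\<not> ?thesis"
  define deg where "deg a = - v a" for a
  have deg_nonneg: "deg a \<ge> 0" if "a \<in> R - {0}" for a
    using neg that by (force simp: deg_def)
  obtain f where f: "f \<in> R" "f \<noteq> 0" "v f < 0"
    using V dvr_mem_iff[OF V(1)] by force
  define n where "n = deg f"
  have n: "n > 0"
    using f by (simp add: n_def deg_def)
  define P where "P r a \<longleftrightarrow> a \<in> R - {0} \<and> deg a mod n = r" for r a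
  have "\<exists>g. \<forall>a. P r a \<longrightarrow> P r g \<and> nat (deg g) \<le> nat (deg a)" for r
    using ex_has_least_nat[of "P r" _ "\<lambda>a. nat (deg a)"] by metis
  then obtain g where g: "\<And>r a. P r a \<Longrightarrow> P r (g r) \<and> nat (deg (g r)) \<le> nat (deg a)"
    by metis
  \<comment> \<open>\<open>e\<close> is the slope of a lower bound for \<open>n * u\<close> against
    the degree, and \<open>B\<close> is its error term, which controls the finitely many generators
    \<open>g r\<close>.\<close>
  define e where "e = min (u f) 0"
  define B where "B = (\<Sum>r\<in>{0..<n}. \<bar>n * u (g r)\<bar>)"
  have e: "e \<le> 0" "e \<le> u f"
    by (auto simp: e_def)
  have B: "n * u (g r) \<ge> - B" if "r \<in> {0..<n}" for r
    using that member_le_sum[of r "{0..<n}" "\<lambda>r. \<bar>n * u (g r)\<bar>"] by (auto simp: B_def)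
  \<comment> \<open>Removing the leading term, a constant times \<open>f ^ j * g r\<close>, lowers
    the degree, so the bound follows by induction from the one for these products.\<close>
  have bound: "n * u a \<ge> e * deg a - B" if "a \<in> R - {0}" for a
    using that
  proof (induction "nat (deg a)" arbitrary: a rule: less_induct)
    case less
    define r where "r = deg a mod n"
    have r: "r \<in> {0..<n}"
      using n by (simp add: r_def)
    have Pa: "P r a"
      using less.prems by (simp add: P_def r_def)
    from g[OF this] have gr: "g r \<in> R - {0}" "deg (g r) mod n = deg a mod n" "nat (deg (g r)) \<le> nat (deg a)"
      by (auto simp: P_def r_def)
    have dg: "0 \<le> deg (g r)" "deg (g r) \<le> deg a"
      using gr deg_nonneg[OF gr(1)] deg_nonneg[OF less.prems] by auto
    obtain q where q: "deg a - deg (g r) = n * q"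
      using gr(2) by (metis mod_eq_dvd_iff dvdE)
    then have "q \<ge> 0"
      using dg n by (metis diff_ge_0_iff_ge zero_le_mult_iff not_less)
    then obtain j where j: "q = int j"
      using nonneg_int_cases by blast
    define b where "b = f ^ j * g r"
    have b: "b \<in> R" "b \<noteq> 0"
      using f gr subring_R by (auto simp: b_def intro: subring_set_closed)
    have "v b = v a"
      using q f gr by (simp add: b_def dvr_mult[OF V(1)] dvr_power[OF V(1)] j n_def deg_def algebra_simps)
    then obtain c where c: "c \<noteq> 0" "a - \<phi> c * b = 0 \<or> v a < v (a - \<phi> c * b)"
      using dvr_leading_constant[OF V(1,2), of a b] b less.prems by auto
    have ub: "n * u (\<phi> c * b) \<ge> e * deg a - B"
    proof -
      have "u (\<phi> c * b) = int j * u f + u (g r)"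
        using f gr c hom_nonzero[of c]
        by (simp add: b_def dvr_mult[OF U(1)] dvr_power[OF U(1)] dvr_hom[OF U(1,2)])
      then have "n * u (\<phi> c * b) = (deg a - deg (g r)) * u f + n * u (g r)"
        unfolding q j by (simp add: algebra_simps)
      moreover have "(deg a - deg (g r)) * u f \<ge> (deg a - deg (g r)) * e"
        using dg e by (intro mult_left_mono) auto
      moreover have "deg (g r) * e \<le> 0"
        using dg e by (intro mult_nonneg_nonpos)
      ultimately show ?thesis
        using B[OF r] by (simp add: algebra_simps)
    qed
    define a' where "a' = a - \<phi> c * b"
    show ?case
    proof (cases "a' = 0")
      case True
      then show ?thesis
        using ub by (simp add: a'_def)
    next
      case False
      have a': "a' \<in> R - {0}"
        using False less.prems b range_R subring_R
        by (auto simp: a'_def intro!: subring_set_diff subring_set_mult)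
      have "deg a' < deg a"
        using False c by (simp add: a'_def deg_def)
      moreover from this have "nat (deg a') < nat (deg a)"
        using deg_nonneg[OF a'] by auto
      ultimately have "n * u a' \<ge> e * deg a' - B"
        using less.hyps a' by blast
      moreover have "e * deg a' \<ge> e * deg a"
        using \<open>deg a' < deg a\<close> e by (intro mult_left_mono_neg) auto
      ultimately have ua': "n * u a' \<ge> e * deg a - B"
        by linarith
      have "u a' \<le> u (a' + \<phi> c * b) \<or> u (\<phi> c * b) \<le> u (a' + \<phi> c * b)"
        using False b c hom_nonzero less.prems by (intro dvr_add_ge[OF U(1)]) (auto simp: a'_def)
      then have "u a' \<le> u a \<or> u (\<phi> c * b) \<le> u a"
        by (simp add: a'_def)
      then have "n * u a' \<le> n * u a \<or> n * u (\<phi> c * b) \<le> n * u a"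
        using n by auto
      then show ?thesis
        using ub ua' by linarith
    qed
  qed
  have lower: "n * u a \<ge> e * deg a" if a: "a \<in> R - {0}" for a
  proof (rule ccontr)
    assume "\<not> ?thesis"
    then have *: "n * u a + 1 \<le> e * deg a" by simp
    have B0: "B \<ge> 0"
      by (simp add: B_def sum_nonneg)
    define N where "N = nat (B + 1)"
    have N: "int N = B + 1"
      using B0 by (simp add: N_def)
    have "a ^ N \<in> R - {0}"
      using a subring_R by (auto intro: subring_set_power)
    from bound[OF this] have "n * (int N * u a) \<ge> e * (int N * deg a) - B"
      using a by (simp add: deg_def dvr_power[OF V(1)] dvr_power[OF U(1)])
    moreover have "int N * (n * u a + 1) \<le> int N * (e * deg a)"
      using * by (intro mult_left_mono) auto
    ultimately show False
      using N by (simp add: algebra_simps)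
  qed
  \<comment> \<open>With \<open>e = 0\<close> no element of \<open>R\<close> would have a pole at
    \<open>U\<close>.\<close>
  have e_neg: "e < 0"
  proof (rule ccontr)
    assume "\<not> e < 0"
    then have "e = 0"
      using e by simp
    then have "u a \<ge> 0" if "a \<in> R - {0}" for a
      using lower[OF that] n by (simp add: zero_le_mult_iff)
    then show False
      using U dvr_mem_iff[OF U(1)] by force
  qed
  then have uf: "u f = e"
    by (simp add: e_def)
  \<comment> \<open>The \<open>n\<close>-th power of \<open>a\<close> has the same leading term at
    \<open>V\<close> as a constant times the power of \<open>f\<close> with exponent
    \<open>deg a\<close>. The difference has smaller degree, so by \<open>lower\<close> its value
    under \<open>u\<close> is larger, and \<open>u\<close> agrees on the two powers.\<close>
  have eq_R: "n * u a = e * deg a" if a: "a \<in> R - {0}" for a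
  proof -
    define i where "i = nat n"
    define j where "j = nat (deg a)"
    have ij: "int i = n" "int j = deg a"
      using n deg_nonneg[OF a] by (auto simp: i_def j_def)
    have nz: "a ^ i \<noteq> 0" "f ^ j \<noteq> 0"
      using a f by auto
    have va: "v (a ^ i) = - (n * deg a)"
      using a by (simp add: dvr_power[OF V(1)] ij deg_def)
    have "v (f ^ j) = - (n * deg a)"
      using f by (simp add: dvr_power[OF V(1)] ij) (simp add: n_def deg_def)
    then obtain c where c: "c \<noteq> 0" "a ^ i - \<phi> c * f ^ j = 0 \<or> v (a ^ i) < v (a ^ i - \<phi> c * f ^ j)"
      using dvr_leading_constant[OF V(1,2) nz] va by metis
    define y where "y = a ^ i - \<phi> c * f ^ j"
    define w where "w = \<phi> c * f ^ j"
    have w: "w \<noteq> 0" "u w = e * deg a"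
      using nz c hom_nonzero f
      by (auto simp: w_def dvr_mult[OF U(1)] dvr_hom[OF U(1,2)] dvr_power[OF U(1)] uf ij)
    have "u w < u y" if "y \<noteq> 0"
    proof -
      have "y \<in> R - {0}"
        using that a f range_R subring_R
        by (auto simp: y_def intro!: subring_set_diff subring_set_mult subring_set_power)
      from lower[OF this] have "n * u y \<ge> e * deg y" .
      moreover have "deg y < n * deg a"
        using c that va by (auto simp: y_def deg_def)
      then have "e * (n * deg a) < e * deg y"
        using e_neg by (rule mult_strict_left_mono_neg)
      ultimately have "n * (e * deg a) < n * u y"
        by (simp add: algebra_simps)
      then show ?thesis
        using n w by simp
    qed
    then have "u (w + y) = u w"
      using dvr_add_eq[OF U(1) w(1)] by blast
    then have "u (a ^ i) = e * deg a"
      using w by (simp add: y_def w_def)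
    then show ?thesis
      using a by (simp add: dvr_power[OF U(1)] ij)
  qed
  have "n * u z = (- e) * v z" if z: "z \<noteq> 0" for z
  proof -
    obtain a b where ab: "a \<in> R" "b \<in> R - {0}" "z = a / b"
      using fractions by blast
    moreover from this have "a \<in> R - {0}"
      using z by auto
    ultimately show ?thesis
      using eq_R[of a] eq_R[of b]
      by (simp add: dvr_divide[OF U(1)] dvr_divide[OF V(1)] deg_def algebra_simps)
  qed
  \<comment> \<open>Both \<open>n\<close> and \<open>- e\<close> are positive, so \<open>u z\<close>
    and \<open>v z\<close> have the same sign.\<close>
  then have "z \<in> U \<longleftrightarrow> z \<in> V" for z
    using n e_neg dvr_mem_iff[OF U(1), of z] dvr_mem_iff[OF V(1), of z]
    by (metis neg_0_less_iff_less zero_le_mult_iff not_less less_le_not_le)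
  then show False
    using UV by auto
qed

lemma exists_unit_multiple:
  assumes V: "dvr V v" and f: "f \<noteq> 0" "v f < 0" and h: "h \<noteq> 0" "v h > 0"
  obtains i j where "j > 0" "v (f ^ i * h ^ j) = 0"
proof
  show "nat (- v f) > 0"
    using f by simp
  show "v (f ^ nat (v h) * h ^ nat (- v f)) = 0"
    using f h by (simp add: dvr_mult[OF V] dvr_power[OF V])
qed

lemma subring_above_place:
  assumes V: "dvr V v" "range \<phi> \<subseteq> V" and h: "h \<in> R" "h \<noteq> 0" "v h > 0"
    and B: "subring_set B" "R \<inter> V \<subseteq> B" "B \<subseteq> R" "B \<noteq> R \<inter> V"
  shows "B = R"
proof -
  obtain f where f: "f \<in> B" "f \<in> R" "f \<noteq> 0" "v f < 0"
    using B dvr_mem_iff[OF V(1)] by force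
  obtain i j where ij: "j > 0" "v (f ^ i * h ^ j) = 0"
    using exists_unit_multiple[OF V(1) f(3,4) h(2,3)] .
  define w where "w = f ^ i * h ^ j"
  have w: "w \<in> R" "w \<noteq> 0" "v w = 0"
    using f h ij subring_R by (auto simp: w_def intro!: subring_set_mult subring_set_power)
  then obtain c where c: "c \<noteq> 0" "w - \<phi> c = 0 \<or> 0 < v (w - \<phi> c)"
    using dvr_leading_constant[OF V, of w 1] dvr_one[OF V(1)] by auto
  define \<pi> where "\<pi> = w - \<phi> c"
  have \<pi>: "\<pi> \<in> R" "\<pi> = 0 \<or> 0 < v \<pi>"
    using c w range_R subring_R by (auto simp: \<pi>_def intro: subring_set_diff)
  have \<phi>c: "\<phi> (inverse c) \<in> B"
    using B(2) V(2) range_R by blast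
  \<comment> \<open>Induction on a bound \<open>N\<close> for the pole order:
    \<open>h ^ j * g\<close> and \<open>\<pi> * g\<close> have smaller poles, and together with
    \<open>f ^ i\<close> in \<open>B\<close> they produce \<open>\<phi> c * g\<close>.\<close>
  have "g \<in> B" if "g \<in> R" "g \<noteq> 0 \<longrightarrow> v g \<ge> - int N" for g N
    using that
  proof (induction N arbitrary: g)
    case 0
    then show ?case
      using B dvr_mem_iff[OF V(1), of g] by auto
  next
    case (Suc N)
    show ?case
    proof (cases "g = 0")
      case True
      then show ?thesis
        using B by auto
    next
      case False
      have "v (h ^ j) > 0"
        using h ij by (simp add: dvr_power[OF V(1)])
      then have "h ^ j * g \<in> B"
        using Suc.prems False h subring_R
        by (intro Suc.IH) (auto simp: dvr_mult[OF V(1)] intro!: subring_set_mult subring_set_power)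
      then have "f ^ i * (h ^ j * g) \<in> B"
        using B(1) f(1) subring_set_mult subring_set_power by blast
      moreover have "\<pi> * g \<in> B"
        using Suc.prems False \<pi> subring_R
        by (intro Suc.IH) (auto simp: dvr_mult[OF V(1)] intro!: subring_set_mult)
      ultimately have "\<phi> (inverse c) * (f ^ i * (h ^ j * g) - \<pi> * g) \<in> B"
        by (intro subring_set_mult[OF B(1) \<phi>c] subring_set_diff[OF B(1)])
      moreover have "f ^ i * (h ^ j * g) - \<pi> * g = \<phi> c * g"
        by (simp add: \<pi>_def w_def algebra_simps)
      ultimately show ?thesis
        using c hom_nonzero[of c] by (simp add: hom_inverse flip: mult.assoc)
    qed
  qed
  note pole_bound = this
  have "R \<subseteq> B"
  proof
    fix g assume "g \<in> R"
    then show "g \<in> B"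
      using pole_bound[of g "nat (- v g)"] by auto
  qed
  with B show ?thesis by blast
qed

text \<open>Such a \<open>Q\<close> would contain \<open>h\<close>, hence also its multiple
  \<open>f ^ i * h ^ j\<close>, which is a unit of \<open>V\<close>; \<open>j > 0\<close> provides
  the factor \<open>h\<close>.\<close>

lemma place_prime_not_contracted:
  assumes V: "dvr V v" "\<not> R \<subseteq> V" and h: "h \<in> R" "h \<noteq> 0" "v h > 0"
    and Q: "prime_of Q R"
  shows "Q \<inter> V \<noteq> nonunits V \<inter> R"
proof
  assume eq: "Q \<inter> V = nonunits V \<inter> R"
  obtain f where f: "f \<in> R" "f \<noteq> 0" "v f < 0"
    using V dvr_mem_iff[OF V(1)] by force
  obtain i j where ij: "j > 0" "v (f ^ i * h ^ j) = 0"
    using exists_unit_multiple[OF V(1) f(2,3) h(2,3)] .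
  have "h \<in> Q"
  proof -
    have "h \<in> nonunits V \<inter> R"
      using h by (simp add: dvr_nonunits_iff[OF V(1)])
    then show ?thesis
      using eq by blast
  qed
  then have "f ^ i * h ^ (j - 1) * h \<in> Q"
    using f h subring_R
    by (intro ideal_of_mult[OF prime_of_ideal[OF Q]] subring_set_mult subring_set_power)
  then have "f ^ i * h ^ j \<in> Q"
    using power_minus_mult[OF ij(1), of h] by (simp add: mult.assoc)
  moreover have "f ^ i * h ^ j \<in> V" "f ^ i * h ^ j \<notin> nonunits V"
    using ij f h by (auto simp: dvr_mem_iff[OF V(1)] dvr_nonunits_iff[OF V(1)])
  ultimately show False
    using eq by blast
qed

end

section \<open>Regular local rings\<close>

lemma ring_on_simps [simp]:
  "carrier (ring_on A) = A" "\<zero>\<^bsub>ring_on A\<^esub> = 0" "\<one>\<^bsub>ring_on A\<^esub> = 1"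
  "x \<oplus>\<^bsub>ring_on A\<^esub> y = x + y" "x \<otimes>\<^bsub>ring_on A\<^esub> y = x * y"
  by (simp_all add: ring_of_type_algebra_def)

lemma ring_of_type_algebra_eq_ring_on: "(ring_of_type_algebra :: 'a::comm_ring_1 ring) = ring_on UNIV"
  by (simp add: ring_of_type_algebra_def)

lemma ring_of_type_algebra_simps [simp]:
  "carrier (ring_of_type_algebra :: 'a::comm_ring_1 ring) = UNIV"
  "\<one>\<^bsub>ring_of_type_algebra\<^esub> = (1 :: 'a)"
  "x \<oplus>\<^bsub>ring_of_type_algebra\<^esub> y = x + (y :: 'a)" "x \<otimes>\<^bsub>ring_of_type_algebra\<^esub> y = x * (y :: 'a)"
  by (simp_all add: ring_of_type_algebra_def)

lemma a_inv_ring_of_type_algebra [simp]: "\<ominus>\<^bsub>ring_of_type_algebra\<^esub> x = - (x :: 'a::comm_ring_1)"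
proof -
  interpret ring "ring_of_type_algebra :: 'a ring" by (rule ring_from_type_algebra)
  show ?thesis
    by (rule minus_equality) (simp_all add: ring_of_type_algebra_def)
qed

lemma subring_iff_subring_set: "subring A (ring_of_type_algebra :: 'a::comm_ring_1 ring) \<longleftrightarrow> subring_set A"
proof
  interpret ring "ring_of_type_algebra :: 'a ring" by (rule ring_from_type_algebra)
  show "subring_set A" if "subring A ring_of_type_algebra"
    unfolding subring_set_def
  proof (intro conjI ballI)
    show "1 \<in> A"
      using subringE(3)[OF that] by simp
    fix x y assume xy: "x \<in> A" "y \<in> A"
    show "x * y \<in> A"
      using subringE(6)[OF that xy] by simp
    show "x - y \<in> A"
      using subringE(7)[OF that xy(1) subringE(5)[OF that xy(2)]] by simp
  qed
  show "subring A ring_of_type_algebra" if "subring_set A"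
    using that by (intro subringI) (auto intro: subring_set_closed)
qed

lemma cring_ring_on:
  assumes "subring_set (A :: 'a::comm_ring_1 set)"
  shows "cring (ring_on A)"
proof (rule cringI)
  show "abelian_group (ring_on A)"
    using assms by (intro abelian_groupI) (auto simp: algebra_simps intro: subring_set_closed bexI[of _ "- _"])
  show "comm_monoid (ring_on A)"
    using assms by (intro comm_monoidI) (auto simp: algebra_simps intro: subring_set_closed)
qed (simp add: algebra_simps)

lemma a_inv_ring_on:
  assumes "subring_set A" "x \<in> (A :: 'a::comm_ring_1 set)"
  shows "\<ominus>\<^bsub>ring_on A\<^esub> x = - x"
proof -
  interpret cring "ring_on A" using assms(1) by (rule cring_ring_on)
  show ?thesis
    using assms by (intro minus_equality) (auto intro: subring_set_uminus)
qed

lemma ideal_ring_on_iff: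
  assumes A: "subring_set (A :: 'a::comm_ring_1 set)"
  shows "ideal I (ring_on A) \<longleftrightarrow> ideal_of I A"
proof
  interpret cring "ring_on A" using A by (rule cring_ring_on)
  show "ideal_of I A" if "ideal I (ring_on A)"
  proof -
    interpret ideal I "ring_on A" by fact
    show ?thesis
      unfolding ideal_of_def using a_subset zero_closed a_closed I_l_closed by auto
  qed
  show "ideal I (ring_on A)" if I: "ideal_of I A"
  proof (rule idealI)
    show "ring (ring_on A)" by (rule ring_axioms)
    show "subgroup I (add_monoid (ring_on A))"
    proof (rule add.subgroupI)
      show "\<ominus>\<^bsub>ring_on A\<^esub> a \<in> I" if "a \<in> I" for a
        using that I A ideal_of_uminus[OF I A] a_inv_ring_on[OF A] ideal_of_subset[OF I] by simp
    qed (use I in \<open>auto simp: ideal_of_def\<close>)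
  qed (use ideal_of_mult[OF I] ideal_of_mult_right[OF I] in simp_all)
qed

lemma primeideal_ring_on_iff:
  assumes A: "subring_set (A :: 'a::comm_ring_1 set)"
  shows "primeideal P (ring_on A) \<longleftrightarrow> prime_of P A"
proof
  assume "primeideal P (ring_on A)"
  then interpret primeideal P "ring_on A" .
  have I: "ideal_of P A"
    using is_ideal ideal_ring_on_iff[OF A] by simp
  have "1 \<notin> P"
  proof
    assume "1 \<in> P"
    then have "A \<subseteq> P"
      using ideal_of_mult[OF I, of _ 1] by auto
    then show False
      using I_notcarr ideal_of_subset[OF I] by auto
  qed
  then show "prime_of P A"
    unfolding prime_of_def using I I_prime by auto
next
  assume P: "prime_of P A"
  show "primeideal P (ring_on A)"
  proof (rule primeidealI)
    show "ideal P (ring_on A)"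
      using prime_of_ideal[OF P] ideal_ring_on_iff[OF A] by simp
    show "cring (ring_on A)"
      using A by (rule cring_ring_on)
    show "carrier (ring_on A) \<noteq> P"
      using prime_of_one[OF P] A by auto
  qed (use prime_of_mult[OF P] in auto)
qed

lemma prime_spectrum_ring_on: "subring_set A \<Longrightarrow> prime_spectrum (ring_on A) = {P. prime_of P A}"
  by (simp add: prime_spectrum_def primeideal_ring_on_iff)

lemma prime_spectrum_type: "prime_spectrum ring_of_type_algebra = {P. prime_of P UNIV}"
  by (rule trans[OF arg_cong[OF ring_of_type_algebra_eq_ring_on, of prime_spectrum]
        prime_spectrum_ring_on[OF subring_set_UNIV]])

lemma affine_model_eq: "subring_set B \<Longrightarrow> affine_model B = localization_at B ` {P. prime_of P B}"
  by (simp add: affine_model_def prime_spectrum_ring_on)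

lemma subring_set_generate_ring: "subring_set (generate_ring ring_of_type_algebra (H :: 'a::comm_ring_1 set))"
proof -
  interpret ring "ring_of_type_algebra :: 'a ring" by (rule ring_from_type_algebra)
  show ?thesis
    using generate_ring_is_subring[of H] by (simp add: subring_iff_subring_set)
qed

lemma generate_ring_least:
  assumes "subring_set B" "H \<subseteq> B"
  shows "generate_ring ring_of_type_algebra (H :: 'a::comm_ring_1 set) \<subseteq> B"
proof -
  interpret ring "ring_of_type_algebra :: 'a ring" by (rule ring_from_type_algebra)
  show ?thesis
    using generate_ring_min_subring1[of H B] assms by (simp add: subring_iff_subring_set)
qed

lemma generate_ring_incl: "H \<subseteq> generate_ring ring_of_type_algebra H"
  by (auto intro: generate_ring.incl)

lemma prime_of_zero: "subring_set A \<Longrightarrow> prime_of {0} (A :: 'a::idom set)"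
  by (auto simp: prime_of_def ideal_of_def)

lemma krull_dim_geI:
  assumes "\<forall>i\<le>n. P i \<in> prime_spectrum R" "\<forall>i<n. P i \<subset> P (Suc i)"
  shows "enat n \<le> krull_dim R"
  unfolding krull_dim_def using assms by (intro Sup_upper) blast

lemma krull_dim_one_chain:
  assumes dim: "krull_dim R = 1" and P: "P\<^sub>0 \<in> prime_spectrum R" "P\<^sub>1 \<in> prime_spectrum R"
    "P\<^sub>2 \<in> prime_spectrum R" "P\<^sub>0 \<subset> P\<^sub>1"
  shows "\<not> P\<^sub>1 \<subset> P\<^sub>2"
proof
  assume *: "P\<^sub>1 \<subset> P\<^sub>2"
  define P where "P i = (if i = 0 then P\<^sub>0 else if i = 1 then P\<^sub>1 else P\<^sub>2)" for i :: nat
  have "enat 2 \<le> krull_dim R"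
    by (rule krull_dim_geI[of _ P]) (use P * in \<open>auto simp: P_def less_Suc_eq numeral_2_eq_2\<close>)
  then show False
    using dim by (simp add: one_enat_def)
qed

section \<open>Regular local rings of the function field as discrete valuation rings\<close>

lemma nonunits_eq_principal:
  assumes p: "local_subring (p :: 'a::field set)" and max: "maximalideal (Idl\<^bsub>ring_on p\<^esub> {t}) (ring_on p)"
    and t: "t \<in> p"
  shows "nonunits p = (\<lambda>r. t * r) ` p"
proof -
  note sub = local_subring_subring[OF p]
  interpret cring "ring_on p" using sub by (rule cring_ring_on)
  let ?I = "Idl\<^bsub>ring_on p\<^esub> {t}"
  interpret maximalideal ?I "ring_on p" by fact
  have I: "ideal_of ?I p"
    using is_ideal ideal_ring_on_iff[OF sub] by simp
  have prim: "ideal_of ((\<lambda>r. t * r) ` p) p"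
    unfolding ideal_of_def
  proof (intro conjI ballI)
    show "(\<lambda>r. t * r) ` p \<subseteq> p"
      using t sub by (auto intro: subring_set_mult)
    show "0 \<in> (\<lambda>r. t * r) ` p"
      using sub by (intro image_eqI[of _ _ 0]) auto
    show "x + y \<in> (\<lambda>r. t * r) ` p" if "x \<in> (\<lambda>r. t * r) ` p" "y \<in> (\<lambda>r. t * r) ` p" for x y
    proof -
      from that obtain r s where "x = t * r" "y = t * s" "r \<in> p" "s \<in> p"
        by blast
      then show ?thesis
        using sub by (intro image_eqI[of _ _ "r + s"]) (auto simp: distrib_left intro: subring_set_add)
    qed
    show "a * x \<in> (\<lambda>r. t * r) ` p" if "a \<in> p" "x \<in> (\<lambda>r. t * r) ` p" for a x
    proof -
      from that(2) obtain r where "x = t * r" "r \<in> p"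
        by blast
      then show ?thesis
        using sub that by (intro image_eqI[of _ _ "a * r"]) (auto intro: subring_set_mult)
    qed
  qed
  have "t \<in> ?I"
    by (auto simp: genideal_def)
  then have "(\<lambda>r. t * r) ` p \<subseteq> ?I"
    using ideal_of_mult_right[OF I] by auto
  moreover have "?I \<subseteq> (\<lambda>r. t * r) ` p"
  proof -
    have "t \<in> (\<lambda>r. t * r) ` p"
      using sub by (intro image_eqI[of _ _ 1]) auto
    then show ?thesis
      unfolding genideal_def using prim ideal_ring_on_iff[OF sub] by auto
  qed
  moreover have "?I \<subseteq> nonunits p"
  proof
    fix x assume x: "x \<in> ?I"
    have "1 \<notin> ?I"
      using I_notcarr ideal_of_mult[OF I, of _ 1] ideal_of_subset[OF I] by auto
    then show "x \<in> nonunits p"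
      using x ideal_of_mult[OF I, of "inverse x" x] ideal_of_subset[OF I x] by (auto simp: nonunits_def)
  qed
  moreover have "nonunits p = ?I \<or> nonunits p = p"
    using I_maximal[of "nonunits p"] nonunits_ideal_of[OF p] ideal_ring_on_iff[OF sub]
      \<open>?I \<subseteq> nonunits p\<close> nonunits_subset by auto
  moreover have "nonunits p \<noteq> p"
    using one_nonunits[of p] sub by auto
  ultimately show ?thesis
    by blast
qed

text \<open>By \<open>sep\<close> division by \<open>t\<close> comes to an end, so every nonzero
  element of the field is \<open>t powi n\<close> times a unit of \<open>p\<close>; the valuation is
  the exponent.\<close>

lemma dvr_of_uniformizer:
  assumes p: "local_subring (p :: 'a::field set)" and t: "t \<noteq> 0" and m: "nonunits p = (\<lambda>r. t * r) ` p"
    and sep: "\<And>a. a \<in> p \<Longrightarrow> a \<noteq> 0 \<Longrightarrow> \<exists>n. a / t ^ n \<notin> p"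
    and frac: "\<And>z. \<exists>a\<in>p. \<exists>b\<in>p - {0}. z = a / b"
  shows "\<exists>v. dvr p v"
proof -
  note sub = local_subring_subring[OF p] and prime = nonunits_prime_of[OF p]
  define U where "U = p - nonunits p"
  have tm: "t \<in> nonunits p"
    unfolding m using sub by (intro image_eqI[of _ _ 1]) auto
  have tp: "t \<in> p"
    using tm by (rule nonunits_subset)
  have U0: "u \<noteq> 0" if "u \<in> U" for u
    using that zero_nonunits[OF sub] by (auto simp: U_def)
  have Umult: "u * w \<in> U" if "u \<in> U" "w \<in> U" for u w
    using that prime_of_mult[OF prime, of u w] subring_set_mult[OF sub, of u w] by (auto simp: U_def)
  have Uinv: "inverse u \<in> U" if "u \<in> U" for u
    using that by (auto simp: U_def unit_inverse inverse_unit)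
  have dec_p: "\<exists>n. \<exists>u\<in>U. a = t powi n * u" if a: "a \<in> p" "a \<noteq> 0" for a
  proof -
    \<comment> \<open>The first exponent at which division fails. It is positive since
      \<open>a\<close> lies in \<open>p\<close>, and its predecessor is the order of
      \<open>a\<close>.\<close>
    define n where "n = (LEAST n. a / t ^ n \<notin> p)"
    have n: "a / t ^ n \<notin> p"
      unfolding n_def using sep[OF a] by (rule LeastI_ex)
    then obtain k where k: "n = Suc k"
      using a by (cases n) auto
    have "a / t ^ k \<in> p"
      using not_less_Least[of k "\<lambda>n. a / t ^ n \<notin> p"] unfolding n_def[symmetric] k by auto
    moreover have "a / t ^ k \<notin> nonunits p"
    proof
      assume "a / t ^ k \<in> nonunits p"
      then obtain r where "r \<in> p" "a / t ^ k = t * r"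
        unfolding m by blast
      then have "r = a / t ^ n"
        using t by (simp add: k field_simps)
      with n \<open>r \<in> p\<close> show False by simp
    qed
    ultimately have "a / t ^ k \<in> U"
      by (simp add: U_def)
    moreover have "a = t powi (int k) * (a / t ^ k)"
      using t by simp
    ultimately show ?thesis by blast
  qed
  have dec: "\<exists>n. \<exists>u\<in>U. z = t powi n * u" if z: "z \<noteq> 0" for z
  proof -
    obtain a b where ab: "a \<in> p" "b \<in> p - {0}" "z = a / b"
      using frac by blast
    then obtain i j u w where "u \<in> U" "w \<in> U" "a = t powi i * u" "b = t powi j * w"
      using dec_p[of a] dec_p[of b] z by auto
    then have "z = t powi (i - j) * (u * inverse w)"
      using ab t by (simp add: power_int_diff divide_inverse)
    then show ?thesis
      using \<open>u \<in> U\<close> \<open>w \<in> U\<close> Umult Uinv by blast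
  qed
  have neg: "n \<ge> 0" if "t powi n * u \<in> p" "u \<in> U" for n u
  proof (rule ccontr)
    assume "\<not> n \<ge> 0"
    then obtain k where k: "n = - int (Suc k)"
      by (metis negD not_le)
    \<comment> \<open>As \<open>n = - (k + 1)\<close>, exactly one factor \<open>inverse t\<close>
      is left.\<close>
    have "t ^ k * (t powi n * u) \<in> p"
      using that(1) tp sub subring_set_mult subring_set_power by blast
    moreover have "t powi n = inverse (t ^ Suc k)"
      unfolding k by (simp only: power_int_minus power_int_of_nat)
    then have "t ^ k * (t powi n * u) = inverse t * u"
      using t by (simp add: field_simps)
    ultimately have "inverse t * u \<in> p"
      by simp
    then have "(inverse t * u) * inverse u \<in> p"
      using subring_set_mult[OF sub, of "inverse t * u" "inverse u"] Uinv[OF that(2)] by (simp add: U_def)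
    then have "inverse t \<in> p"
      using U0[OF that(2)] by (simp add: mult.assoc)
    then show False
      using tm t by (simp add: nonunits_def)
  qed
  have uniq: "n = m'" if "t powi n * u = t powi m' * w" "u \<in> U" "w \<in> U" for n m' u w
  proof -
    have *: "n \<le> m'" if "t powi n * u = t powi m' * w" "u \<in> U" "w \<in> U" for n m' u w
    proof -
      have "t powi (m' - n) * w = u"
        using that t by (simp add: power_int_diff field_simps)
      then show ?thesis
        using neg[of "m' - n" w] that by (simp add: U_def)
    qed
    show ?thesis
      using *[OF that] *[OF that(1)[symmetric] that(3,2)] by simp
  qed
  define v where "v z = (THE n. \<exists>u\<in>U. z = t powi n * u)" for z
  have v: "v (t powi n * u) = n" if "u \<in> U" for n u
    unfolding v_def using that uniq by (intro the_equality) blast+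
  have "dvr p v"
    unfolding dvr_def
  proof (intro conjI allI impI)
    show "subring_set p" by (rule sub)
    fix x y :: 'a assume "x \<noteq> 0" "y \<noteq> 0"
    then obtain i j u w where xy: "u \<in> U" "w \<in> U" "x = t powi i * u" "y = t powi j * w"
      using dec by metis
    then have "x * y = t powi (i + j) * (u * w)"
      using t by (simp add: power_int_add)
    then show "v (x * y) = v x + v y"
      using xy v Umult by metis
  next
    fix x
    show "x \<in> p \<longleftrightarrow> x = 0 \<or> v x \<ge> 0"
    proof (cases "x = 0")
      case True
      then show ?thesis
        using sub by simp
    next
      case False
      then obtain i u where x: "u \<in> U" "x = t powi i * u"
        using dec by blast
      have "x \<in> p" if i: "i \<ge> 0"
      proof -
        obtain k where "i = int k"
          using i nonneg_int_cases by blast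
        then show ?thesis
          using x tp sub by (auto simp: U_def intro!: subring_set_mult subring_set_power)
      qed
      then show ?thesis
        using neg[of i u] x v False by auto
    qed
  next
    have "inverse t \<notin> p"
      using tm t by (simp add: nonunits_def)
    then show "p \<noteq> UNIV" by auto
  qed
  then show ?thesis by blast
qed

context affine_curve
begin

text \<open>A place over \<open>P\<close> has residue field \<open>k\<close>, so an element of
  \<open>Q - P\<close> differs from a constant by an element of \<open>P\<close>. This constant is
  nonzero and lies in \<open>Q\<close>, which is absurd.\<close>

lemma local_ring_prime_chain:
  assumes p: "subring_set p" "range \<phi> \<subseteq> p" and P: "prime_of P p" "prime_of Q p" "P \<noteq> {0}"
  shows "\<not> P \<subset> Q"
proof
  assume "P \<subset> Q"
  then obtain y where y: "y \<in> Q" "y \<notin> P" by blast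
  obtain V where V: "val_in UNIV V" "p \<subseteq> V" "nonunits V \<inter> p = P"
    using exists_val_over_prime[OF p(1) P(1)] .
  have "V \<noteq> UNIV"
    using V(3) P ideal_of_zero[OF prime_of_ideal[OF P(1)]] by auto
  have yp: "y \<in> p"
    using y ideal_of_subset[OF prime_of_ideal[OF P(2)]] by blast
  then obtain c where c: "y - \<phi> c \<in> nonunits V"
    using residue_field_val[OF V(1) \<open>V \<noteq> UNIV\<close>, of y] p V by blast
  moreover have "y - \<phi> c \<in> p"
    using yp p by (auto intro: subring_set_diff)
  ultimately have yc: "y - \<phi> c \<in> P"
    using V by blast
  then have "y - \<phi> c \<in> Q"
    using \<open>P \<subset> Q\<close> by blast
  from ideal_of_diff[OF prime_of_ideal[OF P(2)] p(1) y(1) this] have "\<phi> c \<in> Q"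
    by simp
  then have "\<phi> (inverse c) * \<phi> c \<in> Q"
    using p by (intro ideal_of_mult[OF prime_of_ideal[OF P(2)]]) auto
  moreover have "c \<noteq> 0"
    using yc y by auto
  ultimately show False
    using prime_of_one[OF P(2)] hom_nonzero[of c] by (simp add: hom_inverse)
qed

text \<open>Nonzero primes admit no proper inclusions, so the dimension is one and regularity makes
  the maximal ideal principal. It remains to bound the powers of the generator that divide a nonzero
  element.\<close>

lemma regular_imp_dvr:
  assumes p: "local_subring p" "range \<phi> \<subseteq> p" "p \<noteq> UNIV"
    and frac: "\<And>z. \<exists>a\<in>p. \<exists>b\<in>p - {0}. z = a / b"
    and reg: "regular_local_ring (ring_on p)"
  shows "\<exists>v. dvr p v"
proof -
  note sub = local_subring_subring[OF p(1)]
  have spec: "prime_spectrum (ring_on p) = {P. prime_of P p}"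
    using sub by (rule prime_spectrum_ring_on)
  have m0: "nonunits p \<noteq> {0}"
  proof
    assume *: "nonunits p = {0}"
    have "z \<in> p" for z
    proof -
      obtain a b where "a \<in> p" "b \<in> p - {0}" "z = a / b"
        using frac by blast
      then show ?thesis
        using * sub unit_inverse[of b p] by (auto simp: divide_inverse intro: subring_set_mult)
    qed
    then show False
      using p by auto
  qed
  have dim: "krull_dim (ring_on p) = 1"
  proof (rule antisym)
    have "n \<le> 1" if P: "\<forall>i\<le>n. P i \<in> prime_spectrum (ring_on p)" "\<forall>i<n. P i \<subset> P (Suc i)" for n P
    proof (rule ccontr)
      assume n: "\<not> n \<le> 1"
      then have prime: "prime_of (P 0) p" "prime_of (P 1) p" "prime_of (P 2) p"
        using P(1)[rule_format, of 0] P(1)[rule_format, of 1] P(1)[rule_format, of 2] spec by simp_all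
      have "P 0 \<subset> P 1" "P 1 \<subset> P 2"
        using P(2)[rule_format, of 0] P(2)[rule_format, of 1] n by (simp_all add: numeral_2_eq_2)
      moreover from this(1) have "P 1 \<noteq> {0}"
        using ideal_of_zero[OF prime_of_ideal[OF prime(1)]] by (auto simp: psubset_eq subset_singleton_iff)
      moreover note prime
      ultimately show False
        using local_ring_prime_chain[OF sub p(2), of "P 1" "P 2"] by simp
    qed
    then show "krull_dim (ring_on p) \<le> 1"
      unfolding krull_dim_def by (intro Sup_least) (auto simp: one_enat_def)
    have "enat 1 \<le> krull_dim (ring_on p)"
      by (rule krull_dim_geI[of _ "\<lambda>i. if i = 0 then {0} else nonunits p"])
         (use spec m0 nonunits_prime_of[OF p(1)] prime_of_zero[OF sub] zero_nonunits[OF sub] in auto)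
    then show "1 \<le> krull_dim (ring_on p)"
      by (simp add: one_enat_def)
  qed
  obtain S where S: "S \<subseteq> p" "finite S" "enat (card S) = krull_dim (ring_on p)"
    "maximalideal (Idl\<^bsub>ring_on p\<^esub> S) (ring_on p)"
    using reg unfolding regular_local_ring_def by auto
  then have "card S = 1"
    using dim by (simp add: one_enat_def)
  then obtain t where t: "S = {t}"
    by (rule card_1_singletonE)
  have m: "nonunits p = (\<lambda>r. t * r) ` p"
    using nonunits_eq_principal[OF p(1)] S t by simp
  have t0: "t \<noteq> 0"
  proof
    assume "t = 0"
    then have "nonunits p = {0}"
      using m subring_set_zero[OF sub] by (auto simp: image_constant_conv)
    then show False
      using m0 by simp
  qed
  have tm: "t \<in> nonunits p"
    unfolding m using sub by (intro image_eqI[of _ _ 1]) auto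
  then have tp: "t \<in> p" "inverse t \<notin> p"
    using t0 by (auto simp: nonunits_def)
  \<comment> \<open>The intersection of the powers of the maximal ideal. It turns out to be a prime
    strictly below that ideal, hence zero.\<close>
  define I where "I = {z \<in> p. \<forall>n. z / t ^ n \<in> p}"
  have tI: "t \<notin> I"
  proof
    assume "t \<in> I"
    then have "t / t ^ 2 \<in> p" by (simp add: I_def)
    then show False
      using t0 tp by (simp add: power2_eq_square inverse_eq_divide)
  qed
  have I: "ideal_of I p"
    unfolding ideal_of_def I_def using sub
    by (auto simp: add_divide_distrib intro: subring_set_closed)
       (metis subring_set_mult times_divide_eq_right)
  have shift: "a / t ^ n \<notin> p \<Longrightarrow> \<exists>k. a / t ^ k \<in> p - nonunits p" if "a \<in> p" for a n
  proof (induction n)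
    case 0
    then show ?case using that by simp
  next
    case (Suc n)
    show ?case
    proof (cases "a / t ^ n \<in> p")
      case True
      have "a / t ^ n \<notin> nonunits p"
      proof
        assume "a / t ^ n \<in> nonunits p"
        then obtain r where "r \<in> p" "a / t ^ n = t * r"
          unfolding m by blast
        then have "r = a / t ^ Suc n"
          using t0 by (simp add: field_simps)
        with Suc.prems \<open>r \<in> p\<close> show False by simp
      qed
      with True show ?thesis by blast
    qed (use Suc.IH in blast)
  qed
  have "prime_of I p"
    unfolding prime_of_def
  proof (intro conjI ballI impI)
    show "ideal_of I p" by (rule I)
    show "1 \<notin> I"
      using tI ideal_of_mult[OF I tp(1), of 1] by auto
    fix a b assume ab: "a \<in> p" "b \<in> p" "a * b \<in> I"
    show "a \<in> I \<or> b \<in> I"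
    proof (rule ccontr)
      assume "\<not> ?thesis"
      then obtain n m' where "a / t ^ n \<notin> p" "b / t ^ m' \<notin> p"
        using ab(1,2) by (auto simp: I_def)
      then obtain i j where ij: "a / t ^ i \<in> p - nonunits p" "b / t ^ j \<in> p - nonunits p"
        using shift[OF ab(1)] shift[OF ab(2)] by metis
      \<comment> \<open>The exponent is one more than the order of \<open>a * b\<close>.\<close>
      have "(a * b) / t ^ (i + j + 1) \<in> p"
        using ab(3) by (simp only: I_def mem_Collect_eq)
      then have "t * ((a * b) / t ^ (i + j + 1)) \<in> nonunits p"
        unfolding m by blast
      moreover have "t * ((a * b) / t ^ (i + j + 1)) = (a / t ^ i) * (b / t ^ j)"
        using t0 by (simp add: power_add field_simps)
      ultimately have "(a / t ^ i) * (b / t ^ j) \<in> nonunits p"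
        by metis
      then show False
        using prime_of_mult[OF nonunits_prime_of[OF p(1)], of "a / t ^ i" "b / t ^ j"] ij by blast
    qed
  qed
  moreover from this have "I \<subset> nonunits p"
  proof -
    have "x \<in> nonunits p" if "x \<in> I" for x
    proof (rule ccontr)
      assume "x \<notin> nonunits p"
      then have "inverse x \<in> p" "x \<noteq> 0"
        using that zero_nonunits[OF sub] ideal_of_subset[OF I] by (auto intro: unit_inverse)
      then show False
        using ideal_of_mult[OF I, of "inverse x" x] that prime_of_one[OF \<open>prime_of I p\<close>] by auto
    qed
    then show ?thesis
      using tm tI by blast
  qed
  ultimately have "I = {0}"
    using local_ring_prime_chain[OF sub p(2) _ nonunits_prime_of[OF p(1)]] by blast
  then have "\<exists>n. a / t ^ n \<notin> p" if "a \<in> p" "a \<noteq> 0" for a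
    using that unfolding I_def by blast
  then show ?thesis
    using dvr_of_uniformizer[OF p(1) t0 m _ frac] by blast
qed

end

section \<open>The projective closure\<close>

text \<open>The core of the valuative criterion for projective space: divide by a coordinate of
  least value.\<close>

lemma exists_minimal_coordinate:
  fixes x :: "nat \<Rightarrow> 'a::field"
  assumes V: "val_in UNIV V" and I: "finite I" "I \<noteq> {}" "\<And>i. i \<in> I \<Longrightarrow> x i \<noteq> 0"
  shows "\<exists>i\<in>I. \<forall>j\<in>I. x j / x i \<in> V"
  using I
proof (induction I rule: finite_ne_induct)
  case (singleton i)
  then show ?case
    using val_in_subring[OF V] by simp
next
  case (insert k I)
  then obtain i where i: "i \<in> I" "\<forall>j\<in>I. x j / x i \<in> V"
    by auto
  note sub = val_in_subring[OF V]
  have nz: "x i \<noteq> 0" "x k \<noteq> 0"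
    using i insert.prems by auto
  have "x k / x i \<in> V \<or> x i / x k \<in> V"
    using V by (metis val_in_UNIV inverse_divide)
  then show ?case
  proof
    assume "x k / x i \<in> V"
    then show ?thesis
      using i by auto
  next
    assume ik: "x i / x k \<in> V"
    have "x j / x k \<in> V" if "j \<in> I" for j
      using subring_set_mult[OF sub bspec[OF i(2) that] ik] nz by simp
    then show ?thesis
      using sub nz by (intro bexI[of _ k]) auto
  qed
qed

lemma UNIV_in_affine_model:
  assumes "subring_set A" "\<And>z. \<exists>a\<in>A. \<exists>b\<in>A - {0}. z = a / (b :: 'a::field)"
  shows "UNIV \<in> affine_model A"
proof -
  have "localization_at A {0} = UNIV"
    using assms(2) by (auto simp: localization_at_def) blast
  then show ?thesis
    using prime_of_zero[OF assms(1)] unfolding affine_model_eq[OF assms(1)] by blast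
qed

context affine_curve
begin

abbreviation chart :: "nat \<Rightarrow> (nat \<Rightarrow> 'a) \<Rightarrow> nat \<Rightarrow> 'a set" where
  "chart \<equiv> standard_chart (range \<phi>)"

lemma subring_set_chart: "subring_set (chart n x i)"
  unfolding standard_chart_def by (rule subring_set_generate_ring)

lemma range_subset_chart: "range \<phi> \<subseteq> chart n x i"
  and coordinate_in_chart: "j \<le> n \<Longrightarrow> x j / x i \<in> chart n x i"
  unfolding standard_chart_def
  using generate_ring_incl[of "range \<phi> \<union> {x j / x i |j. j \<le> n}"] by auto

lemma chart_least:
  "subring_set B \<Longrightarrow> range \<phi> \<subseteq> B \<Longrightarrow> (\<And>j. j \<le> n \<Longrightarrow> x j / x i \<in> B) \<Longrightarrow> chart n x i \<subseteq> B"
  unfolding standard_chart_def by (intro generate_ring_least) auto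

text \<open>Regularity makes a point at infinity a discrete valuation ring, and separatedness keeps
  it from containing \<open>R\<close>. Conversely a valuation ring has a centre on \<open>Z\<close>,
  and if the centre lies at infinity it is already a maximal subring.\<close>

lemma places_at_infinity:
  assumes Z: "projective_model (range \<phi>) Z" "affine_model R \<subseteq> Z"
    and reg: "\<forall>p \<in> Z - affine_model R. regular_local_ring (ring_on p)"
  shows "p \<in> Z - affine_model R \<longleftrightarrow> val_in UNIV p \<and> range \<phi> \<subseteq> p \<and> \<not> R \<subseteq> p"
    and "p \<in> Z - affine_model R \<Longrightarrow> \<exists>v. dvr p v"
proof -
  obtain n x where nx: "\<exists>i\<le>n. x i \<noteq> 0"
    and Z_eq: "Z = (\<Union>i \<in> {i. i \<le> n \<and> x i \<noteq> 0}. affine_model (chart n x i))"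
    using Z(1) unfolding projective_model_def by blast
  have Z_iff: "p \<in> Z \<longleftrightarrow> (\<exists>i P. i \<le> n \<and> x i \<noteq> 0 \<and> prime_of P (chart n x i) \<and>
      p = localization_at (chart n x i) P)" for p
    unfolding Z_eq affine_model_eq[OF subring_set_chart] by blast
  have UNIV_aff: "UNIV \<in> affine_model R"
    using UNIV_in_affine_model[OF subring_R fractions] .
  \<comment> \<open>The generic point of \<open>R\<close> is a point of \<open>Z\<close>, so one
    chart has the whole field as a local ring.\<close>
  then obtain l P where l: "l \<le> n" "x l \<noteq> 0" "prime_of P (chart n x l)"
    "UNIV = localization_at (chart n x l) P"
    using Z(2) Z_iff by blast
  \<comment> \<open>The coordinates of chart \<open>l\<close> are quotients of those of chart
    \<open>i\<close>, so the fraction field of chart \<open>i\<close> contains every localization of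
    chart \<open>l\<close>.\<close>
  have chart_fractions: "localization_at (chart n x i) {0} = UNIV" if i: "i \<le> n" "x i \<noteq> 0" for i
  proof -
    let ?B = "chart n x i" and ?F = "localization_at (chart n x i) {0}"
    have F: "subring_set ?F"
      using subring_set_localization[OF subring_set_chart prime_of_zero[OF subring_set_chart]] .
    have BF: "?B \<subseteq> ?F"
      using subset_localization[OF subring_set_chart prime_of_zero[OF subring_set_chart]] .
    have "x j / x l \<in> ?F" if "j \<le> n" for j
    proof -
      have "x j / x l = (x j / x i) / (x l / x i)"
        using i l by simp
      moreover have "x j / x i \<in> ?B" "x l / x i \<in> ?B - {0}"
        using coordinate_in_chart[of _ n x i] that i l by auto
      ultimately show ?thesis
        unfolding localization_at_def by blast
    qed
    then have "chart n x l \<subseteq> ?F"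
      using F BF range_subset_chart by (intro chart_least) blast+
    moreover have "inverse z \<in> ?F" if "z \<in> ?F" for z
    proof (cases "z = 0")
      case True
      then show ?thesis using F by simp
    next
      case False
      obtain a b where "z = a / b" "a \<in> ?B" "b \<in> ?B - {0}"
        using \<open>z \<in> ?F\<close> unfolding localization_at_def by blast
      then have "inverse z = b / a" "b \<in> ?B" "a \<in> ?B - {0}"
        using False by auto
      then show ?thesis
        unfolding localization_at_def by blast
    qed
    ultimately have "localization_at (chart n x l) P \<subseteq> ?F"
      using F by (auto simp: localization_at_def[of _ P] divide_inverse intro!: subring_set_mult)
    then show ?thesis
      using l(4) by blast
  qed
  have dvr_and_not_R: "(\<exists>v. dvr p v) \<and> range \<phi> \<subseteq> p \<and> \<not> R \<subseteq> p" if p: "p \<in> Z - affine_model R" for p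
  proof -
    obtain i P where i: "i \<le> n" "x i \<noteq> 0" "prime_of P (chart n x i)" "p = localization_at (chart n x i) P"
      using p Z_iff by blast
    let ?B = "chart n x i"
    have loc: "local_subring p"
      unfolding i(4) using subring_set_chart i(3) by (rule local_subring_localization)
    note sub = local_subring_subring[OF loc]
    have Bp: "?B \<subseteq> p"
      unfolding i(4) using subring_set_chart i(3) by (rule subset_localization)
    have mP: "nonunits p \<inter> ?B = P"
      unfolding i(4) using subring_set_chart i(3) by (rule nonunits_localization_Int)
    have kp: "range \<phi> \<subseteq> p"
      using Bp range_subset_chart by blast
    have frac: "\<exists>a\<in>p. \<exists>b\<in>p - {0}. z = a / b" for z
    proof -
      have "z \<in> localization_at ?B {0}"
        using chart_fractions[OF i(1,2)] by simp
      then show ?thesis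
        unfolding localization_at_def using Bp by blast
    qed
    have "p \<noteq> UNIV"
      using p UNIV_aff by blast
    then obtain v where v: "dvr p v"
      using regular_imp_dvr[OF loc kp _ frac] reg p by blast
    \<comment> \<open>Separatedness: otherwise \<open>p\<close> dominates the local ring
      \<open>q\<close> of its centre on \<open>R\<close>, which is also a point of \<open>Z\<close>,
      and the two will be shown equal.\<close>
    have "\<not> R \<subseteq> p"
    proof
      assume R: "R \<subseteq> p"
      define Q where "Q = nonunits p \<inter> R"
      define q where "q = localization_at R Q"
      have Q: "prime_of Q R"
        unfolding Q_def by (rule prime_of_restrict[OF nonunits_prime_of[OF loc] sub subring_R R])
      have q: "q \<in> affine_model R"
        unfolding q_def affine_model_eq[OF subring_R] using Q by blast
      have locq: "local_subring q"
        unfolding q_def using subring_R Q by (rule local_subring_localization)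
      note subq = local_subring_subring[OF locq]
      have qp: "q \<subseteq> p"
        unfolding q_def using sub R by (rule localization_subset) (simp add: Q_def)
      have mqp: "nonunits q \<subseteq> nonunits p"
      proof
        fix z assume "z \<in> nonunits q"
        then obtain a b where ab: "z = a / b" "a \<in> Q" "b \<in> R - Q"
          unfolding q_def nonunits_localization[OF subring_R Q] by blast
        then have "inverse b \<in> p" "a \<in> nonunits p"
          using R unit_inverse[of b p] by (auto simp: Q_def)
        then have "inverse b * a \<in> nonunits p"
          using sub by (intro nonunits_mult)
        then show "z \<in> nonunits p"
          using ab by (simp add: field_simps)
      qed
      obtain j P' where j: "j \<le> n" "x j \<noteq> 0" "prime_of P' (chart n x j)" "q = localization_at (chart n x j) P'"
        using q Z(2) Z_iff by blast
      have Cq: "chart n x j \<subseteq> q"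
        unfolding j(4) using subring_set_chart j(3) by (rule subset_localization)
      have "x i / x j \<in> q"
        using Cq coordinate_in_chart i(1) by blast
      moreover have "x j / x i \<in> p"
        using Bp coordinate_in_chart j(1) by blast
      \<comment> \<open>By domination \<open>x i / x j\<close> is then a unit of \<open>q\<close>,
        so the chart of \<open>p\<close> is contained in \<open>q\<close>.\<close>
      then have "x i / x j \<notin> nonunits p"
        using i j by (auto simp: nonunits_def)
      ultimately have "inverse (x i / x j) \<in> q"
        using mqp by (intro unit_inverse) auto
      then have ji: "x j / x i \<in> q"
        by simp
      have "x r / x i \<in> q" if "r \<le> n" for r
      proof -
        have "x r / x j * (x j / x i) \<in> q"
          using Cq coordinate_in_chart[OF that] ji subq by (intro subring_set_mult) auto
        then show ?thesis
          using j by simp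
      qed
      then have "?B \<subseteq> q"
        using subq Cq range_subset_chart[of n x j] by (intro chart_least) auto
      then have "p \<subseteq> q"
        unfolding i(4) using subq mqp mP by (intro localization_subset) auto
      then show False
        using qp q p by auto
    qed
    then show ?thesis
      using v kp by blast
  qed
  then show "p \<in> Z - affine_model R \<Longrightarrow> \<exists>v. dvr p v"
    by blast
  show "p \<in> Z - affine_model R \<longleftrightarrow> val_in UNIV p \<and> range \<phi> \<subseteq> p \<and> \<not> R \<subseteq> p"
  proof
    assume "p \<in> Z - affine_model R"
    then show "val_in UNIV p \<and> range \<phi> \<subseteq> p \<and> \<not> R \<subseteq> p"
      using dvr_and_not_R dvr_val_in by blast
  next
    assume V: "val_in UNIV p \<and> range \<phi> \<subseteq> p \<and> \<not> R \<subseteq> p"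
    then have val: "val_in UNIV p" by blast
    note sub = val_in_subring[OF val]
    have "\<exists>i\<in>{i. i \<le> n \<and> x i \<noteq> 0}. \<forall>j\<in>{i. i \<le> n \<and> x i \<noteq> 0}. x j / x i \<in> p"
      by (rule exists_minimal_coordinate[OF val]) (use nx in simp_all)
    then obtain i where i: "i \<le> n" "x i \<noteq> 0" "\<And>j. j \<le> n \<Longrightarrow> x j \<noteq> 0 \<Longrightarrow> x j / x i \<in> p"
      by blast
    have "x j / x i \<in> p" if "j \<le> n" for j
      using i(3)[OF that] subring_set_zero[OF sub] by (cases "x j = 0") simp_all
    then have Bp: "chart n x i \<subseteq> p"
      using V sub by (intro chart_least) auto
    define P where "P = nonunits p \<inter> chart n x i"
    define q where "q = localization_at (chart n x i) P"
    have "prime_of P (chart n x i)"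
      unfolding P_def
      by (rule prime_of_restrict[OF nonunits_prime_of[OF val_in_local[OF local_subring_UNIV val]] sub
            subring_set_chart Bp])
    then have "q \<in> Z"
      using Z_iff i q_def by blast
    have qp: "q \<subseteq> p"
      unfolding q_def using sub Bp by (rule localization_subset) (simp add: P_def)
    have "q \<notin> affine_model R"
    proof
      assume "q \<in> affine_model R"
      then obtain Q where "prime_of Q R" "q = localization_at R Q"
        unfolding affine_model_eq[OF subring_R] by blast
      then have "R \<subseteq> q"
        using subset_localization[OF subring_R] by blast
      then show False
        using qp V by blast
    qed
    \<comment> \<open>The centre of \<open>p\<close> lies at infinity, so no proper subring of the
      field is strictly larger.\<close>
    then obtain v where "dvr q v"
      using dvr_and_not_R \<open>q \<in> Z\<close> by blast
    have "p \<noteq> UNIV"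
      using V by blast
    then have "p = q"
      by (rule dvr_maximal[OF \<open>dvr q v\<close> sub qp])
    then show "p \<in> Z - affine_model R"
      using \<open>q \<in> Z\<close> \<open>q \<notin> affine_model R\<close> by blast
  qed
qed

lemma two_places_of_uncontracted_prime:
  assumes A: "subring_set A" "range \<phi> \<subseteq> A" "A \<subseteq> R" and P: "prime_of P A"
    and uncontracted: "\<And>Q. prime_of Q R \<Longrightarrow> Q \<inter> A \<noteq> P"
  obtains V U where "val_in UNIV V" "A \<subseteq> V" "\<not> R \<subseteq> V"
    and "val_in UNIV U" "range \<phi> \<subseteq> U" "\<not> R \<subseteq> U" "U \<noteq> V"
proof -
  obtain V where V: "val_in UNIV V" "A \<subseteq> V" "nonunits V \<inter> A = P"
    using exists_val_over_prime[OF A(1) P] .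
  \<comment> \<open>Otherwise the centre of \<open>V\<close> on \<open>R\<close> would contract to
    \<open>P\<close>.\<close>
  have nR: "\<not> R \<subseteq> V"
  proof
    assume R: "R \<subseteq> V"
    have "prime_of (nonunits V \<inter> R) R"
      by (rule prime_of_restrict[OF nonunits_prime_of[OF val_in_local[OF local_subring_UNIV V(1)]]
            val_in_subring[OF V(1)] subring_R R])
    from uncontracted[OF this] show False
      using V A by blast
  qed
  \<comment> \<open>The zero ideal of \<open>A\<close> is contracted from that of
    \<open>R\<close>.\<close>
  have "P \<noteq> {0}"
    using uncontracted[OF prime_of_zero[OF subring_R]] A by (auto simp: subring_set_zero)
  then obtain f where f: "f \<in> P" "f \<noteq> 0"
    using ideal_of_zero[OF prime_of_ideal[OF P]] by blast
  have fV: "f \<in> nonunits V" "f \<in> R"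
    using f V A by auto
  \<comment> \<open>A function without poles is algebraic over \<open>k\<close>, hence constant, and
    a constant vanishing at \<open>V\<close> is zero.\<close>
  have "\<exists>U \<in> vals UNIV (range \<phi>). f \<notin> U"
  proof (rule ccontr)
    assume "\<not> ?thesis"
    then have "algebraic_mod UNIV (range \<phi>) f"
      using f by (intro algebraic_mod_if_in_all_vals[OF local_subring_UNIV subring_set_range]) auto
    then obtain p i where p: "p \<in> poly_over (range \<phi>)" "coeff p i \<noteq> 0" "poly p f = 0"
      by (auto simp: algebraic_mod_def)
    obtain q where q: "p = map_poly \<phi> q"
      using poly_over_range[OF p(1)] .
    have "q \<noteq> 0"
      using p(2) by (auto simp: q)
    then obtain c where "f - \<phi> c = 0"
      using exists_shift_in_nonunits[OF local_subring_UNIV, of f q] p(3) by (auto simp: q)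
    then have "\<phi> c \<in> nonunits V" "f = \<phi> c"
      using fV by auto
    then show False
      using range_nonunits[of V c] A V f by auto
  qed
  then obtain U where U: "val_in UNIV U" "range \<phi> \<subseteq> U" "f \<notin> U"
    by (auto simp: vals_def)
  moreover have "\<not> R \<subseteq> U" "U \<noteq> V"
    using U fV nonunits_subset by blast+
  ultimately show ?thesis
    using that V nR by blast
qed

end

section \<open>Transfer between the domain and its image in the fraction field\<close>

lemma inj_to_fract: "inj (to_fract :: 'r::idom \<Rightarrow> 'r fract)"
  by (simp add: inj_def)

lemma subring_set_to_fract_iff: "subring_set (to_fract ` A) \<longleftrightarrow> subring_set (A :: 'r::idom set)"
proof -
  have "1 \<in> to_fract ` A \<longleftrightarrow> 1 \<in> A"
    using inj_image_mem_iff[OF inj_to_fract, of 1 A] by simp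
  moreover have "to_fract x - to_fract y \<in> to_fract ` A \<longleftrightarrow> x - y \<in> A"
    "to_fract x * to_fract y \<in> to_fract ` A \<longleftrightarrow> x * y \<in> A" for x y :: 'r
    using inj_image_mem_iff[OF inj_to_fract, of "x - y" A]
      inj_image_mem_iff[OF inj_to_fract, of "x * y" A] by simp_all
  ultimately show ?thesis
    unfolding subring_set_def by (simp del: to_fract_diff to_fract_mult)
qed

lemma prime_of_to_fract_iff: "prime_of (to_fract ` P) (to_fract ` A) \<longleftrightarrow> prime_of P (A :: 'r::idom set)"
proof -
  note mem = inj_image_mem_iff[OF inj_to_fract]
  have "1 \<in> to_fract ` P \<longleftrightarrow> 1 \<in> P" "0 \<in> to_fract ` P \<longleftrightarrow> 0 \<in> P"
    using mem[of 1 P] mem[of 0 P] by simp_all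
  moreover have "to_fract x + to_fract y \<in> to_fract ` P \<longleftrightarrow> x + y \<in> P"
    "to_fract x * to_fract y \<in> to_fract ` P \<longleftrightarrow> x * y \<in> P" for x y :: 'r
    using mem[of "x + y" P] mem[of "x * y" P] by simp_all
  ultimately show ?thesis
    unfolding prime_of_def ideal_of_def
    by (simp add: mem inj_image_subset_iff[OF inj_to_fract] del: to_fract_add to_fract_mult)
qed

lemma extending_iff:
  assumes "subring_set (A :: 'r::idom set)"
  shows "extending A ring_of_type_algebra \<longleftrightarrow>
    (\<exists>P. prime_of P A \<and> (\<forall>Q. prime_of Q UNIV \<longrightarrow> Q \<inter> A \<noteq> P))"
  unfolding extending_def prime_spectrum_type prime_spectrum_ring_on[OF assms] by blast

lemma extending_maximal_subalgebra_iff: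
  fixes \<eta> :: "'k \<Rightarrow> 'r::idom"
  shows "extending_maximal_subalgebra \<eta> A \<longleftrightarrow>
    subring_set A \<and> range \<eta> \<subseteq> A \<and> A \<noteq> UNIV \<and>
    (\<forall>B. subring_set B \<longrightarrow> A \<subseteq> B \<longrightarrow> B \<noteq> A \<longrightarrow> B = UNIV) \<and>
    (\<exists>P. prime_of P A \<and> (\<forall>Q. prime_of Q UNIV \<longrightarrow> Q \<inter> A \<noteq> P))"
  unfolding extending_maximal_subalgebra_def maximal_subring_def
  by (auto simp: subring_iff_subring_set extending_iff psubset_eq)

locale affine_curve_ring =
  fixes \<eta> :: "'k::alg_closed_field \<Rightarrow> 'r::idom"
  assumes hom: "\<eta> \<in> ring_hom ring_of_type_algebra ring_of_type_algebra"
    and fin_gen: "finitely_generated_algebra \<eta>"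
    and dim: "krull_dim (ring_of_type_algebra :: 'r ring) = 1"
begin

text \<open>A fixed choice of generators, so that the interpretation below can name them.\<close>

definition gens :: "'r set" where
  "gens = (SOME S. finite S \<and> generate_ring ring_of_type_algebra (range \<eta> \<union> S) = UNIV)"

lemma gens: "finite gens" "generate_ring ring_of_type_algebra (range \<eta> \<union> gens) = UNIV"
  using someI_ex[OF fin_gen[unfolded finitely_generated_algebra_def]] by (auto simp: gens_def)

sublocale affine_curve "\<lambda>c. to_fract (\<eta> c)" "range (to_fract :: 'r \<Rightarrow> 'r fract)" "to_fract ` gens"
proof
  fix x y
  show "to_fract (\<eta> 1) = 1" "to_fract (\<eta> (x + y)) = to_fract (\<eta> x) + to_fract (\<eta> y)"
    "to_fract (\<eta> (x * y)) = to_fract (\<eta> x) * to_fract (\<eta> y)"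
    using ring_hom_one[OF hom] ring_hom_add[OF hom, of x y] ring_hom_mult[OF hom, of x y] by simp_all
next
  show "subring_set (range (to_fract :: 'r \<Rightarrow> 'r fract))"
    by (simp add: subring_set_to_fract_iff)
  show "finite (to_fract ` gens)"
    using gens by simp
  show "range to_fract \<subseteq> B"
    if B: "subring_set B" "range (\<lambda>c. to_fract (\<eta> c)) \<subseteq> B" "to_fract ` gens \<subseteq> B" for B :: "'r fract set"
  proof -
    have "subring_set (to_fract -` B)"
      using B(1) unfolding subring_set_def by simp
    moreover have "range \<eta> \<union> gens \<subseteq> to_fract -` B"
      using B by auto
    ultimately have "UNIV \<subseteq> to_fract -` B"
      using generate_ring_least[of "to_fract -` B"] gens(2) by metis
    then show ?thesis by auto
  qed
  show "\<exists>a\<in>range to_fract. \<exists>b\<in>range to_fract - {0}. z = a / b" for z :: "'r fract"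
  proof (cases z)
    case (Fract a b)
    then have "z = to_fract a / to_fract b"
      by (simp add: to_fract_def)
    moreover have "to_fract b \<noteq> 0"
      using Fract by simp
    ultimately show ?thesis by blast
  qed
  show "P = Q"
    if PQ: "prime_of P (range to_fract)" "prime_of Q (range to_fract)" "P \<subseteq> Q" "P \<noteq> {0}"
    for P Q :: "'r fract set"
  proof (rule ccontr)
    assume ne: "P \<noteq> Q"
    have "P = to_fract ` (to_fract -` P)" "Q = to_fract ` (to_fract -` Q)"
      using PQ(1,2)[THEN prime_of_ideal] ideal_of_subset by blast+
    then obtain P' Q' where eq: "P = to_fract ` P'" "Q = to_fract ` Q'"
      by blast
    have pr: "prime_of P' UNIV" "prime_of Q' UNIV"
      using PQ(1,2) unfolding eq prime_of_to_fract_iff .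
    have "P' \<subset> Q'"
      using PQ(3) ne unfolding eq by (auto simp: inj_image_subset_iff[OF inj_to_fract])
    \<comment> \<open>With the zero ideal this completes a chain of three primes, too long for
      dimension one.\<close>
    moreover have "{0} \<subset> P'"
      using ideal_of_zero[OF prime_of_ideal[OF pr(1)]] PQ(4) unfolding eq by force
    ultimately show False
      using krull_dim_one_chain[OF dim, of "{0}" P' Q'] pr prime_of_zero[of "UNIV :: 'r set"]
      by (auto simp: prime_spectrum_type)
  qed
qed auto

end

theorem theorem1p0p2:
  fixes \<eta> :: "'k::alg_closed_field \<Rightarrow> 'r::idom"
    and Xbar Xaff :: "'r fract set set"
  defines "Xaff \<equiv> affine_variety_of TYPE('r)"
  assumes "\<eta> \<in> ring_hom ring_of_type_algebra ring_of_type_algebra"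
    and "finitely_generated_algebra \<eta>"
    and "krull_dim (ring_of_type_algebra :: 'r ring) = 1"
    and "projective_closure \<eta> Xbar"
    and "\<forall>p \<in> Xbar - Xaff. regular_local_ring (ring_on p)"
  shows "(is_singleton (Xbar - Xaff) \<longrightarrow> \<not> (\<exists>A. extending_maximal_subalgebra \<eta> A)) \<and>
         (\<not> is_singleton (Xbar - Xaff) \<longrightarrow>
            (\<forall>p \<in> Xbar - Xaff. extending_maximal_subalgebra \<eta> {f. to_fract f \<in> p}) \<and>
            (\<forall>A. extending_maximal_subalgebra \<eta> A \<longrightarrow>
                 (\<exists>p \<in> Xbar - Xaff. A = {f. to_fract f \<in> p})))"
proof -
  interpret affine_curve_ring \<eta>
    using assms(2-4) by unfold_locales
  let ?R = "range (to_fract :: 'r \<Rightarrow> 'r fract)" and ?k = "range (\<lambda>c. to_fract (\<eta> c))"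
  have Xaff: "Xaff = affine_model ?R"
    by (simp add: Xaff_def affine_variety_of_def)
  note closure = assms(5)[unfolded projective_closure_def affine_variety_of_def]
  note places = places_at_infinity[OF closure[THEN conjunct1] closure[THEN conjunct2]
      assms(6)[unfolded Xaff], folded Xaff]
  have kR: "?k \<subseteq> V \<longleftrightarrow> range \<eta> \<subseteq> {f. to_fract f \<in> V}" for V :: "'r fract set"
    by auto
  have trace: "to_fract ` {f. to_fract f \<in> V} = ?R \<inter> V" for V :: "'r fract set"
    by auto
  \<comment> \<open>The point \<open>V\<close> recovers \<open>A\<close>; the second point
    \<open>U\<close> excludes the case of a single point at infinity.\<close>
  have two: "\<exists>V U. V \<in> Xbar - Xaff \<and> U \<in> Xbar - Xaff \<and> U \<noteq> V \<and> A = {f. to_fract f \<in> V}"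
    if ext: "extending_maximal_subalgebra \<eta> A" for A
  proof -
    obtain P where A: "subring_set A" "range \<eta> \<subseteq> A" "A \<noteq> UNIV"
      and max: "\<And>B. subring_set B \<Longrightarrow> A \<subseteq> B \<Longrightarrow> B \<noteq> A \<Longrightarrow> B = UNIV"
      and P: "prime_of P A" "\<And>Q. prime_of Q UNIV \<Longrightarrow> Q \<inter> A \<noteq> P"
      using ext unfolding extending_maximal_subalgebra_iff by blast
    have uncontracted: "Q \<inter> to_fract ` A \<noteq> to_fract ` P" if Q: "prime_of Q ?R" for Q
    proof
      assume eq: "Q \<inter> to_fract ` A = to_fract ` P"
      have "Q = to_fract ` (to_fract -` Q)"
        using Q[THEN prime_of_ideal] ideal_of_subset by blast
      then have "prime_of (to_fract -` Q) UNIV"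
        using Q prime_of_to_fract_iff[of "to_fract -` Q" UNIV] by simp
      moreover have "to_fract -` Q \<inter> A = P"
      proof -
        have "to_fract ` (to_fract -` Q \<inter> A) = Q \<inter> to_fract ` A"
          by auto
        also note eq
        finally have "to_fract ` (to_fract -` Q \<inter> A) = to_fract ` P" .
        then show ?thesis
          unfolding inj_image_eq_iff[OF inj_to_fract] .
      qed
      ultimately show False
        using P(2) by blast
    qed
    have A': "subring_set (to_fract ` A)" "?k \<subseteq> to_fract ` A" "to_fract ` A \<subseteq> ?R"
      "prime_of (to_fract ` P) (to_fract ` A)"
      using A P by (auto simp: subring_set_to_fract_iff prime_of_to_fract_iff)
    obtain V U where V: "val_in UNIV V" "to_fract ` A \<subseteq> V" "\<not> ?R \<subseteq> V"
      and U: "val_in UNIV U" "?k \<subseteq> U" "\<not> ?R \<subseteq> U" "U \<noteq> V"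
      by (rule two_places_of_uncontracted_prime[OF A' uncontracted])
    have "V \<in> Xbar - Xaff" "U \<in> Xbar - Xaff"
      unfolding places(1)
      by (intro conjI U V subset_trans[OF A'(2) V(2)])+
    \<comment> \<open>The trace of \<open>V\<close> contains \<open>A\<close> and is proper because
      \<open>V\<close> does not contain \<open>R\<close>, so maximality applies.\<close>
    moreover have "{f. to_fract f \<in> V} = A"
    proof (rule ccontr)
      assume ne: "{f. to_fract f \<in> V} \<noteq> A"
      have "subring_set {f. to_fract f \<in> V}"
        using val_in_subring[OF V(1)] by (simp add: subring_set_def)
      moreover have "A \<subseteq> {f. to_fract f \<in> V}"
        using V(2) by blast
      ultimately have "{f. to_fract f \<in> V} = UNIV"
        using ne by (rule max)
      then show False
        using V(3) by blast
    qed
    ultimately show ?thesis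
      using U(4) by blast
  qed
  have place: "extending_maximal_subalgebra \<eta> {f. to_fract f \<in> V}"
    if VU: "V \<in> Xbar - Xaff" "U \<in> Xbar - Xaff" "U \<noteq> V" for V U
  proof -
    obtain v u where dvr: "dvr V v" "dvr U u"
      using places(2) VU by blast
    have V: "?k \<subseteq> V" "\<not> ?R \<subseteq> V" and U: "?k \<subseteq> U" "\<not> ?R \<subseteq> U"
      using places(1)[of V] places(1)[of U] VU by simp_all
    \<comment> \<open>The existence of a second point \<open>U\<close> guarantees a nonzero function
      vanishing at \<open>V\<close>.\<close>
    obtain h where h: "h \<in> ?R" "h \<noteq> 0" "v h > 0"
      using exists_zero_at_place[OF dvr(1) V dvr(2) U VU(3)] by blast
    let ?A = "{f. to_fract f \<in> V}" and ?P = "{f. to_fract f \<in> nonunits V}"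
    note sub = dvr_subring[OF dvr(1)]
    have loc: "local_subring V"
      using val_in_local[OF local_subring_UNIV dvr_val_in[OF dvr(1)]] .
    have subA: "subring_set ?A"
      using sub by (simp add: subring_set_def)
    have "B = UNIV" if B: "subring_set B" "?A \<subseteq> B" "B \<noteq> ?A" for B
    proof -
      have "to_fract ` B \<noteq> ?R \<inter> V"
        using B(3) unfolding trace[symmetric] inj_image_eq_iff[OF inj_to_fract] .
      moreover have "?R \<inter> V \<subseteq> to_fract ` B"
        using B(2) by blast
      ultimately have "to_fract ` B = ?R"
        using B(1) subring_set_to_fract_iff by (intro subring_above_place[OF dvr(1) V(1) h]) blast+
      then show ?thesis
        unfolding inj_image_eq_iff[OF inj_to_fract] .
    qed
    moreover have "prime_of ?P ?A"
    proof -
      have "prime_of (nonunits V \<inter> (?R \<inter> V)) (?R \<inter> V)"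
        using subA by (intro prime_of_restrict[OF nonunits_prime_of[OF loc] sub])
          (auto simp flip: trace simp: subring_set_to_fract_iff)
      moreover have "to_fract ` ?P = nonunits V \<inter> (?R \<inter> V)"
        using nonunits_subset by auto
      ultimately show ?thesis
        unfolding trace[symmetric] by (metis prime_of_to_fract_iff)
    qed
    \<comment> \<open>The centre \<open>?P\<close> of \<open>V\<close> on \<open>?A\<close> is the
      prime missed by the map of spectra.\<close>
    moreover have "Q \<inter> ?A \<noteq> ?P" if Q: "prime_of Q UNIV" for Q
    proof
      assume eq: "Q \<inter> ?A = ?P"
      have "prime_of (to_fract ` Q) ?R"
        using Q by (simp add: prime_of_to_fract_iff)
      then have "to_fract ` Q \<inter> V \<noteq> nonunits V \<inter> ?R"
        using place_prime_not_contracted[OF dvr(1) V(2) h] by blast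
      moreover have "to_fract ` Q \<inter> V = to_fract ` (Q \<inter> ?A)"
        by auto
      moreover have "to_fract ` ?P = nonunits V \<inter> ?R"
        by auto
      ultimately show False
        using eq by simp
    qed
    ultimately show ?thesis
      unfolding extending_maximal_subalgebra_iff using subA V kR by blast
  qed
  show ?thesis
  proof (intro conjI impI ballI allI notI)
    assume "is_singleton (Xbar - Xaff)" "\<exists>A. extending_maximal_subalgebra \<eta> A"
    then show False
      using two unfolding is_singleton_def by (metis singletonD)
  next
    fix p assume "\<not> is_singleton (Xbar - Xaff)" and p: "p \<in> Xbar - Xaff"
    then obtain U where "U \<in> Xbar - Xaff" "U \<noteq> p"
      unfolding is_singleton_def by blast
    then show "extending_maximal_subalgebra \<eta> {f. to_fract f \<in> p}"
      using place p by blast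
  next
    fix A assume "extending_maximal_subalgebra \<eta> A"
    then show "\<exists>p \<in> Xbar - Xaff. A = {f. to_fract f \<in> p}"
      using two by blast
  qed
qed

end
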